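(* Let $m,n\ge 2$ be integers and let $p_1,\dots,p_m>0$ with $\sum_{i=1}^m p_i=1$ be the symbol probabilities of a Bernoulli source. Then there exist a constant $c>0$ (depending only on $n$ and $p_1,\dots,p_m$) and an infinite set $\mathcal T$ of integers $T\ge 2$ such that for every $T\in\mathcal T$ there is a decipherable word-based code from the source alphabet $\{a_1,\dots,a_m\}$ to the output alphabet $\{b_1,\dots,b_n\}$ whose redundancy $R$, average delay $\bar N$ and maximum delay $N$ satisfy $$R\le c\,\bar N^{-1}T^{-2},\qquad \bar N\le c\,T^3,\qquad N\le c\,T^3\ln T .$$
   Context: A Bernoulli source produces independent symbols from the input alphabet $\{a_1,\dots,a_m\}$ with probabilities $p_1,\dots,p_m$; its entropy is $H=-\sum_{i=1}^m p_i\log_2 p_i$. A message is an infinite sequence of input symbols. For a word $A=a_{i_1}\cdots a_{i_k}$, $|A|=k$ is its length and $p(A)=p_{i_1}\cdots p_{i_k}$. A word-based code consists of a finite set of distinct nonempty words $A_1,A_2,\dots$ over the input alphabet such that every message can be uniquely represented as an infinite concatenation of words $A_j$ (in particular, the set is prefix-free and every message begins with one of its words), together with a map $\phi$ assigning to each $A_j$ a word $\phi(A_j)$ over the output alphabet $\{b_1,\dots,b_n\}$. The code is decipherable if $\phi(A_{i_1})\cdots\phi(A_{i_s})=\phi(A_{j_1})\cdots\phi(A_{j_t})$ always implies $s=t$ and $i_k=j_k$ for $k=1,\dots,s$. Average delay: $\bar N=\sum_j p(A_j)|A_j|$. Maximum delay: $N=\max_j|A_j|$. Redundancy: $R=\bar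 N^{-1}\sum_j p(A_j)|\phi(A_j)|-H/\log_2 n$. *)

theory Defs
  imports Complex_Main "HOL-Library.Stream"
begin

text \<open>
  The source alphabet is \<^term>\<open>{1..m}\<close>, the output alphabet \<^term>\<open>{1..n}\<close>;
  words are lists, messages are streams over the source alphabet. Only the values
  \<open>p 1, \<dots>, p m\<close> of a probability assignment \<open>p\<close> are relevant.
\<close>

definition bernoulli_source :: "nat \<Rightarrow> (nat \<Rightarrow> real) \<Rightarrow> bool" where
  "bernoulli_source m p \<longleftrightarrow> (\<forall>i\<in>{1..m}. p i > 0) \<and> (\<Sum>i=1..m. p i) = 1"

definition source_entropy :: "nat \<Rightarrow> (nat \<Rightarrow> real) \<Rightarrow> real" where
  "source_entropy m p = - (\<Sum>i=1..m. p i * log 2 (p i))"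

definition word_prob :: "(nat \<Rightarrow> real) \<Rightarrow> nat list \<Rightarrow> real" where
  "word_prob p A = prod_list (map p A)"

text \<open>
  \<^term>\<open>flat ws\<close> is the infinite concatenation of the words in \<open>ws\<close>. It is meaningful only
  for nonempty words, which the second conjunct guarantees.
\<close>

definition message_dictionary :: "nat \<Rightarrow> nat list set \<Rightarrow> bool" where
  "message_dictionary m W \<longleftrightarrow>
     finite W \<and> [] \<notin> W \<and> W \<subseteq> lists {1..m} \<and>
     (\<forall>x \<in> streams {1..m}. \<exists>!ws. ws \<in> streams W \<and> flat ws = x)"

definition word_code ::
    "nat \<Rightarrow> nat \<Rightarrow> nat list set \<Rightarrow> (nat list \<Rightarrow> nat list) \<Rightarrow> bool" where
  "word_code m n W \<phi> \<longleftrightarrow> message_dictionary m W \<and> (\<forall>A\<in>W. \<phi> A \<in> lists {1..n})"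

text \<open>
  Equality of the sequences \<open>us\<close> and \<open>vs\<close> of dictionary words covers both the equality of their
  lengths and of their entries, because the words of a dictionary are distinct.
\<close>

definition decipherable :: "nat list set \<Rightarrow> (nat list \<Rightarrow> nat list) \<Rightarrow> bool" where
  "decipherable W \<phi> \<longleftrightarrow>
     (\<forall>us \<in> lists W. \<forall>vs \<in> lists W.
        concat (map \<phi> us) = concat (map \<phi> vs) \<longrightarrow> us = vs)"

definition average_delay :: "(nat \<Rightarrow> real) \<Rightarrow> nat list set \<Rightarrow> real" where
  "average_delay p W = (\<Sum>A\<in>W. word_prob p A * real (length A))"

definition max_delay :: "nat list set \<Rightarrow> nat" where
  "max_delay W = Max (length ` W)"

definition redundancy ::
    "nat \<Rightarrow> nat \<Rightarrow> (nat \<Rightarrow> real) \<Rightarrow> nat list set \<Rightarrow> (nat list \<Rightarrow> nat list) \<Rightarrow> real" where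
  "redundancy m n p W \<phi> =
     inverse (average_delay p W) * (\<Sum>A\<in>W. word_prob p A * real (length (\<phi> A)))
       - source_entropy m p / log 2 (real n)"

end

theory Submission
  imports Defs "HOL-Probability.Probability"
begin

text \<open>
  Call \<open>- log\<^sub>n p(w)\<close> the phase of a word \<open>w\<close>. If every dictionary word gets its phase rounded to an
  integer as code length, Wald's identity shows that redundancy times average delay is the mean
  rounding error. Rounding errors of size \<open>1/T\<close> with both signs, balanced so that the Kraft sum lies
  in \<open>[1 - c/T\<^sup>2, 1]\<close>, give a mean error of order \<open>1/T\<^sup>2\<close>, since the linear term of
  \<open>n\<^sup>-\<^sup>e - 1\<close> is controlled by the Kraft sum.

  The dictionary first reads \<open>T\<close> letters and then stages of \<open>O(T\<^sup>2)\<close> letters, stopping after a stage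
  that ends with a phase within \<open>3/T\<close> of an integer on the prescribed side, or after
  \<open>O(T ln T)\<close> stages. A stage succeeds with probability at least \<open>c/T\<close>. The side is chosen greedily
  for each of the initial words, whose probabilities are \<open>O(1/T)\<close>, and this balances the Kraft sum.

  If some letter \<open>i\<close> has irrational phase \<open>\<theta>\<close>, let \<open>T\<close> be the denominator of a convergent of \<open>\<theta>\<close>.
  A stage reads letters until order \<open>T\<^sup>2\<close> of them differ from \<open>i\<close>. Given these, the number of
  letters \<open>i\<close> takes each of \<open>T\<close> consecutive values with probability at least \<open>c/T\<close>, and one of these
  values moves the phase into any prescribed interval of length \<open>3/T\<close> modulo \<open>1\<close>. If all letter
  phases are rational, a bounded number of letters can return to an integer phase.
\<close>

section \<open>Complete dictionaries\<close>

text \<open>Keeps the \<open>1\<close> in \<open>{1..m}\<close> from being rewritten to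
  \<open>Suc 0\<close>, so that facts about the alphabet keep matching.\<close>

declare One_nat_def [simp del]

inductive complete_dict :: "nat \<Rightarrow> nat list set \<Rightarrow> bool" for m where
  leaf: "complete_dict m {[]}"
| node: "(\<And>i. i \<in> {1..m} \<Longrightarrow> complete_dict m (V i)) \<Longrightarrow>
    complete_dict m (\<Union>i\<in>{1..m}. (#) i ` V i)"

text \<open>Sequential stopping: after the word \<open>w\<close> has been read, reading continues by
  a rule \<open>V w\<close> that may depend on \<open>w\<close>.\<close>

definition graft :: "'a list set \<Rightarrow> ('a list \<Rightarrow> 'a list set) \<Rightarrow> 'a list set" where
  "graft W V = (\<Union>w\<in>W. (@) w ` V w)"

text \<open>For a complete dictionary the weights sum to 1, so this is the expectation of
  \<open>f\<close> at the first dictionary word of a random message.\<close>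

definition dict_mean :: "(nat \<Rightarrow> real) \<Rightarrow> nat list set \<Rightarrow> (nat list \<Rightarrow> real) \<Rightarrow> real" where
  "dict_mean p W f = (\<Sum>w\<in>W. word_prob p w * f w)"

lemma word_prob_simps [simp]:
  "word_prob p [] = 1"
  "word_prob p (i # w) = p i * word_prob p w"
  "word_prob p (v @ w) = word_prob p v * word_prob p w"
  by (simp_all add: word_prob_def)

lemma complete_dict_finite: "complete_dict m W \<Longrightarrow> finite W"
  by (induction rule: complete_dict.induct) auto

lemma complete_dict_lists: "complete_dict m W \<Longrightarrow> W \<subseteq> lists {1..m}"
proof (induction rule: complete_dict.induct)
  case (node V)
  have "i # v \<in> lists {1..m}" if "i \<in> {1..m}" "v \<in> V i" for i v
    using node.IH[OF that(1)] that by (simp only: Cons_in_lists_iff) blast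
  then show ?case by blast
qed simp

lemma complete_dict_prefix_free:
  "complete_dict m W \<Longrightarrow> w \<in> W \<Longrightarrow> w' \<in> W \<Longrightarrow> w @ u = w' @ u' \<Longrightarrow> w = w'"
proof (induction arbitrary: w w' rule: complete_dict.induct)
  case (node V)
  then obtain i v j v' where "i \<in> {1..m}" "v \<in> V i" "w = i # v" "j \<in> {1..m}" "v' \<in> V j" "w' = j # v'"
    by auto
  with node show ?case by auto
qed auto

lemma complete_dict_prefix_stream:
  "complete_dict m W \<Longrightarrow> x \<in> streams {1..m} \<Longrightarrow> \<exists>w\<in>W. \<exists>y\<in>streams {1..m}. x = w @- y"
proof (induction arbitrary: x rule: complete_dict.induct)
  case (node V)
  obtain i y where x: "x = i ## y" by (cases x)
  with node.prems have i: "i \<in> {1..m}" and "y \<in> streams {1..m}"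
    by (simp_all only: streams_Stream)
  from node.IH[OF this] obtain v z where "v \<in> V i" "z \<in> streams {1..m}" "y = v @- z" by blast
  with i x show ?case by (intro bexI[of _ "i # v"] bexI[of _ z]) auto
qed auto

lemma complete_dict_prefix_unique:
  assumes W: "complete_dict m W" "w \<in> W" "w' \<in> W" and eq: "w @- y = w' @- y'"
  shows "w = w'"
proof -
  let ?k = "length w + length w'"
  from eq have "stake ?k (w @- y) = stake ?k (w' @- y')" by simp
  then have "w @ stake (length w') y = w' @ stake (length w) y'" by (simp add: stake_shift)
  then show ?thesis using complete_dict_prefix_free[OF W] by blast
qed

text \<open>Grafting onto a node is the same as grafting onto each of its subtrees, with
  \<open>V\<close> shifted by the first letter; hence \<open>V\<close> is generalised in the
  induction.\<close>

lemma complete_dict_graft: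
  "complete_dict m W \<Longrightarrow> (\<And>w. w \<in> W \<Longrightarrow> complete_dict m (V w)) \<Longrightarrow> complete_dict m (graft W V)"
proof (induction arbitrary: V rule: complete_dict.induct)
  case leaf
  then show ?case by (simp add: graft_def)
next
  case (node U)
  have "graft (\<Union>i\<in>{1..m}. (#) i ` U i) V = (\<Union>i\<in>{1..m}. (#) i ` graft (U i) (\<lambda>u. V (i # u)))"
    by (simp add: graft_def image_UN image_image) blast
  moreover have "complete_dict m (graft (U i) (\<lambda>u. V (i # u)))" if "i \<in> {1..m}" for i
    using that by (intro node.IH node.prems) auto
  ultimately show ?case using complete_dict.node by auto
qed

lemma dict_mean_leaf [simp]: "dict_mean p {[]} f = f []"
  by (simp add: dict_mean_def)

lemma dict_mean_node:
  assumes "\<And>i. i \<in> {1..m} \<Longrightarrow> finite (V i)"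
  shows "dict_mean p (\<Union>i\<in>{1..m}. (#) i ` V i) f
    = (\<Sum>i=1..m. p i * dict_mean p (V i) (\<lambda>w. f (i # w)))"
proof -
  have "dict_mean p (\<Union>i\<in>{1..m}. (#) i ` V i) f
      = (\<Sum>i=1..m. \<Sum>w\<in>(#) i ` V i. word_prob p w * f w)"
    unfolding dict_mean_def using assms by (subst sum.UNION_disjoint) auto
  also have "\<dots> = (\<Sum>i=1..m. p i * dict_mean p (V i) (\<lambda>w. f (i # w)))"
    by (intro sum.cong) (auto simp: sum.reindex dict_mean_def sum_distrib_left mult.assoc)
  finally show ?thesis .
qed

text \<open>The tower property of expectation. Prefix-freeness makes the pieces grafted at different
  words disjoint.\<close>

lemma dict_mean_graft:
  assumes W: "complete_dict m W" and V: "\<And>w. w \<in> W \<Longrightarrow> finite (V w)"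
  shows "dict_mean p (graft W V) f = dict_mean p W (\<lambda>w. dict_mean p (V w) (\<lambda>v. f (w @ v)))"
proof -
  have fin: "finite W" using W by (rule complete_dict_finite)
  have "dict_mean p (graft W V) f = (\<Sum>w\<in>W. \<Sum>u\<in>(@) w ` V w. word_prob p u * f u)"
    unfolding dict_mean_def graft_def using V fin
    by (subst sum.UNION_disjoint) (auto dest: complete_dict_prefix_free[OF W])
  also have "\<dots> = dict_mean p W (\<lambda>w. dict_mean p (V w) (\<lambda>v. f (w @ v)))"
  proof (subst dict_mean_def, intro sum.cong refl)
    fix w assume "w \<in> W"
    have "(\<Sum>u\<in>(@) w ` V w. word_prob p u * f u) = (\<Sum>v\<in>V w. word_prob p (w @ v) * f (w @ v))"
      by (subst sum.reindex) (auto simp: inj_on_def)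
    then show "(\<Sum>u\<in>(@) w ` V w. word_prob p u * f u)
        = word_prob p w * dict_mean p (V w) (\<lambda>v. f (w @ v))"
      by (simp add: dict_mean_def sum_distrib_left mult.assoc)
  qed
  finally show ?thesis .
qed

section \<open>Unique parsing of messages\<close>

lemma stream_eq_stake:
  assumes "\<And>k. stake k x = stake k y"
  shows "x = y"
  using assms
proof (coinduction arbitrary: x y)
  case (Eq_stream x y)
  have "stake (Suc k) x = stake (Suc k) y" for k using Eq_stream by blast
  then show ?case by simp
qed

text \<open>A message is parsed by splitting off its first dictionary word again and again.
  Uniqueness follows by coinduction, since prefix-freeness determines the first word of any parse.
  Nonemptiness of the words makes \<open>flat\<close> productive and every step advance.\<close>

lemma message_dictionary_complete:
  assumes W: "complete_dict m W" and ne: "[] \<notin> W"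
  shows "message_dictionary m W"
proof -
  let ?M = "streams {1..m}"
  define hp where "hp x = (SOME w. w \<in> W \<and> (\<exists>y\<in>?M. x = w @- y))" for x
  define tp where "tp x = sdrop (length (hp x)) x" for x
  have hp: "hp x \<in> W" and tp: "tp x \<in> ?M" and split: "hp x @- tp x = x" if "x \<in> ?M" for x
  proof -
    have "hp x \<in> W \<and> (\<exists>y\<in>?M. x = hp x @- y)"
      unfolding hp_def by (rule someI_ex) (use complete_dict_prefix_stream[OF W that] in blast)
    then obtain y where y: "hp x \<in> W" "y \<in> ?M" "x = hp x @- y" by blast
    then have "tp x = y" by (simp add: tp_def sdrop_shift [of _ "hp x" y, folded y(3)])
    with y show "hp x \<in> W" "tp x \<in> ?M" "hp x @- tp x = x" by auto
  qed
  define parse where "parse x = smap hp (siterate tp x)" for x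
  have parse: "shd (parse x) = hp x" "stl (parse x) = parse (tp x)" for x
    by (simp_all add: parse_def)
  have parse_streams: "parse x \<in> streams W" if "x \<in> ?M" for x
    using that
  proof (coinduction arbitrary: x rule: streams.coinduct)
    case (streams x)
    show ?case
      by (intro exI[of _ "hp x"] exI[of _ "parse (tp x)"])
         (use hp[OF streams] tp[OF streams] parse[of x] in \<open>auto simp: stream.expand\<close>)
  qed
  have unfold: "flat (parse x) = hp x @- flat (parse (tp x))" if "x \<in> ?M" for x
    using flat_unfold[of "parse x"] hp[OF that] ne by (metis parse)
  \<comment> \<open>Strong induction on the length of the compared prefix: the nonempty first word
    accounts for some letters, so fewer remain to be compared in the tail.\<close>
  have "stake k (flat (parse x)) = stake k x" if "x \<in> ?M" for k x
    using that
  proof (induction k arbitrary: x rule: less_induct)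
    case (less k)
    let ?l = "length (hp x)"
    have l: "?l > 0" using hp[OF less.prems] ne by auto
    have "stake k (flat (parse x)) = take k (hp x) @ stake (k - ?l) (flat (parse (tp x)))"
      by (simp add: unfold[OF less.prems] stake_shift)
    also have "stake (k - ?l) (flat (parse (tp x))) = stake (k - ?l) (tp x)"
      using less.IH[OF _ tp[OF less.prems], of "k - ?l"] l by (cases "k = 0") auto
    also have "take k (hp x) @ stake (k - ?l) (tp x) = stake k (hp x @- tp x)"
      by (simp add: stake_shift)
    finally show ?case by (simp add: split[OF less.prems])
  qed
  then have flat_parse: "flat (parse x) = x" if "x \<in> ?M" for x
    using that by (metis stream_eq_stake)
  have unique: "ws = ws'" if "ws \<in> streams W" "ws' \<in> streams W" "flat ws = flat ws'" for ws ws'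
    using that
  proof (coinduction arbitrary: ws ws')
    case (Eq_stream ws ws')
    then have in_W: "shd ws \<in> W" "shd ws' \<in> W" and tl: "stl ws \<in> streams W" "stl ws' \<in> streams W"
      by (auto elim: streams.cases)
    with ne have "shd ws \<noteq> []" "shd ws' \<noteq> []" by auto
    with Eq_stream have eq: "shd ws @- flat (stl ws) = shd ws' @- flat (stl ws')"
      by (metis flat_unfold)
    with in_W have "shd ws = shd ws'" by (intro complete_dict_prefix_unique[OF W])
    with eq tl show ?case by auto
  qed
  show ?thesis
    unfolding message_dictionary_def
    using complete_dict_finite[OF W] complete_dict_lists[OF W] ne parse_streams flat_parse unique
    by blast
qed

section \<open>Phases and expectations over a dictionary\<close>

definition phase :: "nat \<Rightarrow> (nat \<Rightarrow> real) \<Rightarrow> nat list \<Rightarrow> real" where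
  "phase n p w = - log n (word_prob p w)"

locale source =
  fixes m n :: nat and p :: "nat \<Rightarrow> real"
  assumes m: "m \<ge> 2" and n: "n \<ge> 2" and source: "bernoulli_source m p"
begin

abbreviation "mean \<equiv> dict_mean p"

lemma p_pos: "i \<in> {1..m} \<Longrightarrow> p i > 0" and p_sum: "(\<Sum>i=1..m. p i) = 1"
  using source by (auto simp: bernoulli_source_def)

lemma word_prob_pos: "w \<in> lists {1..m} \<Longrightarrow> word_prob p w > 0"
  by (induction w) (auto simp: p_pos)

lemma p_less_1: assumes "i \<in> {1..m}" shows "p i < 1"
proof -
  have "(\<Sum>j\<in>{1..m} - {i}. p j) > 0"
  proof (rule sum_pos)
    have "(if i = 1 then 2 else 1) \<in> {1..m} - {i}" using m by auto
    then show "{1..m} - {i} \<noteq> {}" by blast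
  qed (auto intro: p_pos)
  then show ?thesis using p_sum sum.remove[OF _ assms, of p] by simp
qed

lemma word_prob_le_1: "w \<in> lists {1..m} \<Longrightarrow> word_prob p w \<le> 1"
proof (induction w)
  case (Cons i w)
  then have "p i * word_prob p w \<le> 1 * 1"
    using p_less_1[of i] p_pos[of i] word_prob_pos[of w] by (intro mult_mono) auto
  then show ?case by simp
qed simp

lemma phase_append:
  "v \<in> lists {1..m} \<Longrightarrow> w \<in> lists {1..m} \<Longrightarrow> phase n p (v @ w) = phase n p v + phase n p w"
  using word_prob_pos[of v] word_prob_pos[of w] n by (simp add: phase_def log_mult)

lemma phase_Cons:
  "i \<in> {1..m} \<Longrightarrow> w \<in> lists {1..m} \<Longrightarrow> phase n p (i # w) = phase n p [i] + phase n p w"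
  using phase_append[of "[i]" w] by simp

lemma phase_nonneg: "w \<in> lists {1..m} \<Longrightarrow> phase n p w \<ge> 0"
  unfolding phase_def using word_prob_pos[of w] word_prob_le_1[of w] n by simp

lemma word_prob_eq_powr_phase: "w \<in> lists {1..m} \<Longrightarrow> word_prob p w = n powr (- phase n p w)"
  unfolding phase_def using word_prob_pos[of w] n by simp

lemma mean_const: "complete_dict m W \<Longrightarrow> mean W (\<lambda>_. c) = c"
proof (induction rule: complete_dict.induct)
  case (node V)
  then have "mean (\<Union>i\<in>{1..m}. (#) i ` V i) (\<lambda>_. c) = (\<Sum>i=1..m. p i * c)"
    by (subst dict_mean_node) (blast intro: complete_dict_finite, simp)
  then show ?case by (simp add: p_sum flip: sum_distrib_right)
qed simp

lemma mean_mono: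
  assumes "complete_dict m W" "\<And>w. w \<in> W \<Longrightarrow> f w \<le> g w"
  shows "mean W f \<le> mean W g"
  unfolding dict_mean_def
  using assms word_prob_pos complete_dict_lists[OF assms(1)]
  by (intro sum_mono mult_left_mono) (blast intro: less_imp_le)+

lemma mean_add: "mean W (\<lambda>w. f w + g w) = mean W f + mean W g"
  by (simp add: dict_mean_def sum.distrib distrib_left)

lemma mean_diff: "mean W (\<lambda>w. f w - g w) = mean W f - mean W g"
  by (simp add: dict_mean_def sum_subtractf right_diff_distrib)

lemma mean_cmult: "mean W (\<lambda>w. c * f w) = c * mean W f"
  by (simp add: dict_mean_def sum_distrib_left mult.left_commute)

lemma mean_cong: "(\<And>w. w \<in> W \<Longrightarrow> f w = g w) \<Longrightarrow> mean W f = mean W g"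
  by (simp add: dict_mean_def)

lemma mean_phase_letter:
  "(\<Sum>i=1..m. p i * phase n p [i]) = source_entropy m p / log 2 n"
proof -
  have "log n (p i) = log 2 (p i) / log 2 n" for i
    using n by (simp add: log_def)
  then show ?thesis
    by (simp add: phase_def source_entropy_def sum_negf sum_divide_distrib)
qed

text \<open>Wald's identity for the stopping time that reads one dictionary word.\<close>

lemma mean_phase:
  "complete_dict m W \<Longrightarrow>
    mean W (phase n p) = source_entropy m p / log 2 n * mean W (\<lambda>w. real (length w))"
proof (induction rule: complete_dict.induct)
  case leaf
  then show ?case by (simp add: phase_def)
next
  case (node V)
  let ?h = "source_entropy m p / log 2 n"
  have "mean (V i) (\<lambda>w. phase n p (i # w)) = phase n p [i] + mean (V i) (phase n p)"
    if "i \<in> {1..m}" for i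
  proof -
    have "mean (V i) (\<lambda>w. phase n p (i # w)) = mean (V i) (\<lambda>w. phase n p [i] + phase n p w)"
      using node.hyps that complete_dict_lists by (intro mean_cong phase_Cons) blast+
    then show ?thesis using node.hyps that by (simp add: mean_add mean_const)
  qed
  then have "mean (\<Union>i\<in>{1..m}. (#) i ` V i) (phase n p)
      = (\<Sum>i=1..m. p i * (phase n p [i] + ?h * mean (V i) (\<lambda>w. real (length w))))"
    using node by (subst dict_mean_node) (blast intro: complete_dict_finite, simp)
  also have "\<dots> = ?h * (\<Sum>i=1..m. p i * (1 + mean (V i) (\<lambda>w. real (length w))))"
    by (simp only: distrib_left sum.distrib mean_phase_letter p_sum mult_1_right)
       (simp add: sum_distrib_left mult.left_commute)
  also have "(\<Sum>i=1..m. p i * (1 + mean (V i) (\<lambda>w. real (length w))))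
      = mean (\<Union>i\<in>{1..m}. (#) i ` V i) (\<lambda>w. real (length w))"
    using node by (subst dict_mean_node)
      (blast intro: complete_dict_finite, simp add: mean_add mean_const add.commute)
  finally show ?case .
qed

lemma complete_dict_length: "complete_dict m {w \<in> lists {1..m}. length w = k}"
proof (induction k)
  case 0
  have "{w \<in> lists {1..m}. length w = 0} = {[]}" by auto
  then show ?case by (simp add: complete_dict.leaf)
next
  case (Suc k)
  have "{w \<in> lists {1..m}. length w = Suc k}
      = (\<Union>i\<in>{1..m}. (#) i ` {w \<in> lists {1..m}. length w = k})"
    (is "?L = ?R")
  proof (rule set_eqI)
    show "w \<in> ?L \<longleftrightarrow> w \<in> ?R" for w by (cases w) auto
  qed
  then show ?case by (simp only: complete_dict.node[OF Suc])
qed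

end

section \<open>Kraft's inequality\<close>

text \<open>Code words are chosen greedily in order of nondecreasing length. When \<open>a\<close>
  is treated, all earlier lengths are at most \<open>l a\<close>, and strict inequality of the
  earlier Kraft sum leaves a word of length \<open>l a\<close> that extends no earlier code
  word.\<close>

lemma kraft_prefix_code:
  fixes l :: "'a \<Rightarrow> nat"
  assumes "finite W" "n > 0" "(\<Sum>w\<in>W. 1 / real n ^ l w) \<le> 1"
  shows "\<exists>\<phi>. (\<forall>w\<in>W. \<phi> w \<in> lists {1..n} \<and> length (\<phi> w) = l w) \<and>
    (\<forall>w\<in>W. \<forall>w'\<in>W. w \<noteq> w' \<longrightarrow> (\<forall>u u'. \<phi> w @ u \<noteq> \<phi> w' @ u'))"
  using assms(1,3)
proof (induction W rule: finite_ranking_induct[where f = l])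
  case empty
  show ?case by simp
next
  case (insert a W)
  show ?case
  proof (cases "a \<in> W")
    case True
    then show ?thesis using insert by (simp add: insert_absorb)
  next
    case new_word: False
    have "(\<Sum>w\<in>W. 1 / real n ^ l w) < 1"
    proof -
      have "1 / real n ^ l a > 0" using \<open>n > 0\<close> by simp
      then show ?thesis using insert.prems insert.hyps new_word
        by (simp del: zero_less_divide_1_iff)
    qed
    then obtain \<phi> where \<phi>: "\<And>w. w \<in> W \<Longrightarrow> \<phi> w \<in> lists {1..n} \<and> length (\<phi> w) = l w"
      and free: "\<And>w w' u u'. w \<in> W \<Longrightarrow> w' \<in> W \<Longrightarrow> w \<noteq> w' \<Longrightarrow> \<phi> w @ u \<noteq> \<phi> w' @ u'"
      using insert.IH[OF less_imp_le] by blast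
    let ?L = "l a"
    let ?words = "\<lambda>k. {u. set u \<subseteq> {1..n} \<and> length u = k}"
    \<comment> \<open>The words of length \<open>l a\<close> that are blocked because an earlier
      code word is a prefix of them. Their number is at most \<open>n ^ l a\<close> times the
      earlier Kraft sum.\<close>
    define B where "B = (\<Union>w\<in>W. (@) (\<phi> w) ` ?words (?L - l w))"
    have "real (card B) \<le> (\<Sum>w\<in>W. real n ^ (?L - l w))"
    proof -
      have "card B \<le> (\<Sum>w\<in>W. card ((@) (\<phi> w) ` ?words (?L - l w)))"
        unfolding B_def by (rule card_UN_le) (rule insert.hyps)
      also have "\<dots> \<le> (\<Sum>w\<in>W. n ^ (?L - l w))"
        by (intro sum_mono order.trans[OF card_image_le])
           (auto simp: finite_lists_length_eq card_lists_length_eq)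
      finally have "real (card B) \<le> real (\<Sum>w\<in>W. n ^ (?L - l w))" by (rule of_nat_mono)
      then show ?thesis by simp
    qed
    also have "\<dots> = (\<Sum>w\<in>W. real n ^ ?L * (1 / real n ^ l w))"
      using insert.hyps \<open>n > 0\<close> by (intro sum.cong) (auto simp: power_diff)
    also have "\<dots> = real n ^ ?L * (\<Sum>w\<in>W. 1 / real n ^ l w)"
      by (rule sum_distrib_left[symmetric])
    also have "\<dots> < real n ^ ?L * 1"
      using \<open>(\<Sum>w\<in>W. 1 / real n ^ l w) < 1\<close> \<open>n > 0\<close> by (intro mult_strict_left_mono) auto
    finally have "real (card B) < real (n ^ ?L)" by simp
    then have "card B < card (?words ?L)"
      by (simp only: of_nat_less_iff card_lists_length_eq[OF finite_atLeastAtMost] card_atLeastAtMost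
          diff_Suc_1 add_diff_cancel_right')
    moreover have "finite B"
      unfolding B_def using insert.hyps(1) by (intro finite_UN_I finite_imageI finite_lists_length_eq) auto
    ultimately have "\<not> ?words ?L \<subseteq> B" using card_mono[of B "?words ?L"] by linarith
    then obtain c where c: "c \<in> ?words ?L" "c \<notin> B" by blast
    have new: "\<phi> w @ u \<noteq> c @ u'" if "w \<in> W" for w u u'
    proof
      assume eq: "\<phi> w @ u = c @ u'"
      have le: "length (\<phi> w) \<le> length c" using insert.hyps that \<phi> c by auto
      then obtain v where v: "c = \<phi> w @ v"
        using eq by (auto simp: append_eq_append_conv2)
      then have "v \<in> ?words (?L - l w)" using c(1) \<phi>[OF that] by auto
      with v that c(2) show False unfolding B_def by blast
    qed
    show ?thesis
    proof (intro exI[of _ "\<phi>(a := c)"] conjI ballI impI allI)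
      fix w w' u u' assume "w \<in> insert a W" "w' \<in> insert a W" "w \<noteq> w'"
      then show "(\<phi>(a := c)) w @ u \<noteq> (\<phi>(a := c)) w' @ u'"
        using free[of w w' u u'] new[of w u u'] new[of w' u' u] insert.hyps by auto
    qed (use \<phi> c insert.hyps in \<open>auto simp: in_lists_conv_set\<close>)
  qed
qed

text \<open>Code words are peeled off from the left. Two different words are required because a
  single word with empty code would satisfy the prefix condition vacuously.\<close>

lemma prefix_free_decipherable:
  assumes free: "\<And>w w' u u'. w \<in> W \<Longrightarrow> w' \<in> W \<Longrightarrow> w \<noteq> w' \<Longrightarrow> \<phi> w @ u \<noteq> \<phi> w' @ u'"
    and two: "a \<in> W" "b \<in> W" "a \<noteq> b"
  shows "decipherable W \<phi>"
proof -
  have ne: "\<phi> w \<noteq> []" if "w \<in> W" for w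
  proof
    assume "\<phi> w = []"
    obtain w' where "w' \<in> W" "w' \<noteq> w" using two by metis
    then show False using free[OF that \<open>w' \<in> W\<close>, of "\<phi> w'" "[]"] \<open>\<phi> w = []\<close> by auto
  qed
  have "us = vs" if "us \<in> lists W" "vs \<in> lists W" "concat (map \<phi> us) = concat (map \<phi> vs)" for us vs
    using that
  proof (induction us arbitrary: vs)
    case Nil
    then show ?case using ne by (cases vs) auto
  next
    case (Cons u us)
    then obtain v vs' where vs: "vs = v # vs'" using ne by (cases vs) auto
    with Cons.prems have eq: "\<phi> u @ concat (map \<phi> us) = \<phi> v @ concat (map \<phi> vs')" by simp
    moreover have "u \<in> W" "v \<in> W" "vs' \<in> lists W" using Cons.hyps Cons.prems vs by simp_all
    ultimately have "u = v"
      using free[of u v "concat (map \<phi> us)" "concat (map \<phi> vs')"] by auto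
    moreover from this have "us = vs'"
      using Cons.IH[OF \<open>vs' \<in> lists W\<close>] eq by simp
    ultimately show ?case using vs by simp
  qed
  then show ?thesis unfolding decipherable_def by blast
qed

section \<open>Stopping at a good phase\<close>

text \<open>If the running sum is at least \<open>- K\<close>, choose \<open>True\<close>, which
  lowers it by at most \<open>K\<close>; otherwise choose \<open>False\<close>, which raises it by
  at most \<open>K\<close> and so cannot make it positive. The terms \<open>\<eta> a\<close> pay for
  a \<open>False\<close> choice that fails to raise the sum.\<close>

lemma greedy_signs:
  fixes f :: "'a \<Rightarrow> bool \<Rightarrow> real"
  assumes "finite A" and K: "K \<ge> 0"
    and "\<And>a. a \<in> A \<Longrightarrow> - K \<le> f a True \<and> f a True \<le> 0"
    and "\<And>a. a \<in> A \<Longrightarrow> - \<eta> a \<le> f a False \<and> f a False \<le> K \<and> \<eta> a \<ge> 0"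
  shows "\<exists>s. - (2 * K + sum \<eta> A) \<le> (\<Sum>a\<in>A. f a (s a)) \<and> (\<Sum>a\<in>A. f a (s a)) \<le> 0"
  using assms(1,3,4)
proof (induction A rule: finite_induct)
  case empty
  then show ?case using K by simp
next
  case (insert b A)
  then obtain s where s: "- (2 * K + sum \<eta> A) \<le> (\<Sum>a\<in>A. f a (s a))" "(\<Sum>a\<in>A. f a (s a)) \<le> 0"
    by (metis insertCI)
  let ?S = "\<Sum>a\<in>A. f a (s a)"
  have \<eta>: "sum \<eta> A \<ge> 0" using insert.prems(2) by (intro sum_nonneg) auto
  have b: "- K \<le> f b True" "f b True \<le> 0" "- \<eta> b \<le> f b False" "f b False \<le> K" "\<eta> b \<ge> 0"
    using insert.prems by blast+
  have "(\<Sum>a\<in>insert b A. f a ((s(b := t)) a)) = f b t + ?S" for t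
    using insert.hyps by (auto intro!: sum.cong)
  moreover have "\<exists>t. - (2 * K + sum \<eta> (insert b A)) \<le> f b t + ?S \<and> f b t + ?S \<le> 0"
  proof (cases "?S \<ge> - K")
    case True
    then show ?thesis using b s \<eta> insert.hyps by (intro exI[of _ True]) auto
  next
    case False
    then show ?thesis using b s \<eta> insert.hyps by (intro exI[of _ False]) auto
  qed
  ultimately show ?case by metis
qed

context source
begin

text \<open>Success of a stage has probability at least \<open>\<delta>\<close> whatever was read
  before, so the number of stages is dominated by a geometric variable. The mean length obeys
  \<open>L + (1 - \<delta>) * (L / \<delta>) = L / \<delta>\<close>, and each stage multiplies the
  failure probability by at most \<open>1 - \<delta>\<close>.\<close>

lemma repeat_stages:
  fixes B :: "nat list \<Rightarrow> nat list set" and L \<delta> :: real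
  assumes B: "\<And>w. w \<in> lists {1..m} \<Longrightarrow> complete_dict m (B w)"
    and L: "\<And>w v. w \<in> lists {1..m} \<Longrightarrow> v \<in> B w \<Longrightarrow> real (length v) \<le> L"
    and \<delta>: "0 < \<delta>" "\<delta> \<le> 1"
    and hit: "\<And>w. w \<in> lists {1..m} \<Longrightarrow> \<delta> \<le> mean (B w) (\<lambda>v. of_bool (G (w @ v)))"
    and w: "w \<in> lists {1..m}"
    and L0: "0 \<le> L"
  shows "\<exists>D. complete_dict m D \<and> (\<forall>v\<in>D. real (length v) \<le> L * S) \<and>
    mean D (\<lambda>v. real (length v)) \<le> L / \<delta> \<and> mean D (\<lambda>v. of_bool (\<not> G (w @ v))) \<le> (1 - \<delta>) ^ S"
  using w
proof (induction S arbitrary: w)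
  case 0
  have "0 \<le> L" by (rule L0)
  then show ?case using \<delta> by (intro exI[of _ "{[]}"]) (auto intro: complete_dict.leaf)
next
  case (Suc S)
  let ?P = "\<lambda>w D. complete_dict m D \<and> (\<forall>v\<in>D. real (length v) \<le> L * S) \<and>
    mean D (\<lambda>v. real (length v)) \<le> L / \<delta> \<and> mean D (\<lambda>v. of_bool (\<not> G (w @ v))) \<le> (1 - \<delta>) ^ S"
  have "\<forall>w\<in>lists {1..m}. \<exists>D. ?P w D" using Suc.IH by blast
  from bchoice[OF this] obtain D where "\<forall>w\<in>lists {1..m}. ?P w (D w)" ..
  then have D: "\<And>w. w \<in> lists {1..m} \<Longrightarrow> complete_dict m (D w)"
    and len: "\<And>w v. w \<in> lists {1..m} \<Longrightarrow> v \<in> D w \<Longrightarrow> real (length v) \<le> L * S"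
    and avg: "\<And>w. w \<in> lists {1..m} \<Longrightarrow> mean (D w) (\<lambda>v. real (length v)) \<le> L / \<delta>"
    and bad: "\<And>w. w \<in> lists {1..m} \<Longrightarrow> mean (D w) (\<lambda>v. of_bool (\<not> G (w @ v))) \<le> (1 - \<delta>) ^ S"
    by blast+
  note w = Suc.prems
  note Bw = B[OF w]
  have wv: "w @ v \<in> lists {1..m}" if "v \<in> B w" for v
    using complete_dict_lists[OF Bw] w that by auto
  \<comment> \<open>Stop where the first stage was successful; elsewhere append the rule with
    \<open>S\<close> further stages.\<close>
  define V where "V v = (if G (w @ v) then {[]} else D (w @ v))" for v
  have V: "complete_dict m (V v)" if "v \<in> B w" for v
    unfolding V_def using D[OF wv[OF that]] by (auto intro: complete_dict.leaf)
  note mean_V = dict_mean_graft[OF Bw complete_dict_finite[OF V]]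
  have "real (length u) \<le> L * Suc S" if u: "u \<in> graft (B w) V" for u
  proof -
    from u obtain v x where "u = v @ x" "v \<in> B w" "x \<in> V v" by (auto simp: graft_def)
    moreover have "real (length x) \<le> L * S"
      using \<open>x \<in> V v\<close> len[OF wv[OF \<open>v \<in> B w\<close>]] L0 by (auto simp: V_def split: if_splits)
    ultimately show ?thesis using L[OF w] by (simp add: algebra_simps) (meson add_mono)
  qed
  moreover have "mean (graft (B w) V) (\<lambda>v. real (length v)) \<le> L / \<delta>"
  proof -
    have "mean (graft (B w) V) (\<lambda>v. real (length v))
        = mean (B w) (\<lambda>v. mean (V v) (\<lambda>u. real (length v) + real (length u)))"
      by (simp add: mean_V)
    also have "\<dots> = mean (B w) (\<lambda>v. real (length v) + mean (V v) (\<lambda>u. real (length u)))"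
      by (intro mean_cong) (simp add: mean_add mean_const[OF V])
    also have "\<dots> \<le> mean (B w) (\<lambda>v. L + (L / \<delta>) * (1 - of_bool (G (w @ v))))"
      using L[OF w] avg[OF wv] by (intro mean_mono Bw add_mono) (auto simp: V_def)
    also have "\<dots> = L + (L / \<delta>) * (1 - mean (B w) (\<lambda>v. of_bool (G (w @ v))))"
      by (simp only: mean_add mean_cmult mean_diff mean_const[OF Bw])
    also have "\<dots> \<le> L + (L / \<delta>) * (1 - \<delta>)"
      using hit[OF w] L0 \<delta> by (intro add_left_mono mult_left_mono) auto
    also have "\<dots> = L / \<delta>" using \<delta> by (simp add: field_simps)
    finally show ?thesis .
  qed
  moreover have "mean (graft (B w) V) (\<lambda>v. of_bool (\<not> G (w @ v))) \<le> (1 - \<delta>) ^ Suc S"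
  proof -
    have "mean (graft (B w) V) (\<lambda>v. of_bool (\<not> G (w @ v)))
        = mean (B w) (\<lambda>v. mean (V v) (\<lambda>u. of_bool (\<not> G ((w @ v) @ u))))"
      by (simp add: mean_V)
    also have "\<dots> \<le> mean (B w) (\<lambda>v. (1 - \<delta>) ^ S * (1 - of_bool (G (w @ v))))"
      using bad[OF wv] by (intro mean_mono Bw) (auto simp: V_def)
    also have "\<dots> = (1 - \<delta>) ^ S * (1 - mean (B w) (\<lambda>v. of_bool (G (w @ v))))"
      by (simp only: mean_add mean_cmult mean_diff mean_const[OF Bw])
    also have "\<dots> \<le> (1 - \<delta>) ^ S * (1 - \<delta>)"
      using hit[OF w] \<delta> by (intro mult_left_mono) auto
    finally show ?thesis by (simp add: mult.commute)
  qed
  moreover have "complete_dict m (graft (B w) V)" using V by (rule complete_dict_graft[OF Bw])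
  ultimately show ?case by blast
qed

end

text \<open>The flag \<open>s\<close> is the side on which the phase may miss an integer: it is rounded up if \<open>s\<close> holds
  and down otherwise. Phases that are not near an integer are always rounded up, which can only
  help Kraft's inequality.\<close>

definition near_integer :: "bool \<Rightarrow> real \<Rightarrow> real \<Rightarrow> bool" where
  "near_integer s \<gamma> y \<longleftrightarrow> (if s then of_int \<lceil>y\<rceil> - y \<le> \<gamma> else y - of_int \<lfloor>y\<rfloor> \<le> \<gamma>)"

definition code_length :: "bool \<Rightarrow> real \<Rightarrow> real \<Rightarrow> nat" where
  "code_length s \<gamma> y = nat (if s \<or> \<not> near_integer s \<gamma> y then \<lceil>y\<rceil> else \<lfloor>y\<rfloor>)"

lemma code_length_bounds:
  fixes y \<gamma> :: real
  defines "e \<equiv> \<lambda>s. real (code_length s \<gamma> y) - y"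
  assumes "y \<ge> 0"
  shows "near_integer True \<gamma> y \<Longrightarrow> 0 \<le> e True \<and> e True \<le> \<gamma>"
    and "near_integer False \<gamma> y \<Longrightarrow> - \<gamma> \<le> e False \<and> e False \<le> 0"
    and "\<not> near_integer s \<gamma> y \<Longrightarrow> 0 \<le> e s \<and> e s \<le> 1"
  using assms(2) unfolding e_def code_length_def near_integer_def
  by (auto split: if_splits) (linarith+)?

text \<open>A second-order bound that keeps the linear term exact, because that term is to be traded
  for the Kraft excess. Multiplying \<open>1 + u \<le> exp u\<close> by \<open>exp (- u)\<close>
  gives \<open>exp (- u) \<le> 1 - u * exp (- u)\<close>, and replacing the last factor by 1 costs
  at most a quadratic term.\<close>

lemma exp_minus_le_quadratic:
  fixes u U :: real
  assumes "\<bar>u\<bar> \<le> U"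
  shows "exp (- u) \<le> 1 - u + u\<^sup>2 * exp U"
proof -
  have *: "v * (exp v - 1) \<le> v\<^sup>2 * exp \<bar>v\<bar>" for v :: real
  proof (cases "v \<ge> 0")
    case True
    have "exp v * (1 - v) \<le> exp v * exp (- v)"
      using exp_ge_add_one_self[of "- v"] by (intro mult_left_mono) auto
    then have "exp v - 1 \<le> v * exp v" by (simp add: exp_minus algebra_simps)
    from mult_left_mono[OF this True] show ?thesis using True by (simp add: power2_eq_square)
  next
    case False
    have "v * (exp v - 1) \<le> v * v"
      by (rule mult_left_mono_neg) (use exp_ge_add_one_self[of v] False in linarith)+
    also have "\<dots> \<le> v\<^sup>2 * exp \<bar>v\<bar>"
      using mult_left_mono[of 1 "exp \<bar>v\<bar>" "v * v"] by (simp add: power2_eq_square)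
    finally show ?thesis .
  qed
  have "exp (- u) * (1 + u) \<le> exp (- u) * exp u"
    using exp_ge_add_one_self[of u] by (intro mult_left_mono) auto
  then have "exp (- u) \<le> 1 - u * exp (- u)" by (simp add: exp_minus algebra_simps)
  also have "\<dots> \<le> 1 - u + u\<^sup>2 * exp \<bar>u\<bar>" using *[of "- u"] by (simp add: algebra_simps)
  also have "\<dots> \<le> 1 - u + u\<^sup>2 * exp U" using assms by (intro add_left_mono mult_left_mono) auto
  finally show ?thesis .
qed

text \<open>Bernoulli's inequality bounds \<open>(1 + a) ^ T\<close> from below, while the product
  of \<open>(1 - a) ^ T\<close> and \<open>(1 + a) ^ T\<close> is at most 1. This weak decay
  suffices for the probabilities of the initial words.\<close>

lemma power_le_inverse_linear:
  fixes a :: real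
  assumes "0 < a" "a < 1" "T > 0"
  shows "(1 - a) ^ T \<le> 1 / (a * real T)"
proof -
  have "(1 - a) ^ T * (1 + T * a) \<le> (1 - a) ^ T * (1 + a) ^ T"
    using assms by (intro mult_left_mono Bernoulli_inequality) auto
  also have "\<dots> = (1 - a\<^sup>2) ^ T"
    by (simp add: power2_eq_square algebra_simps flip: power_mult_distrib)
  also have "\<dots> \<le> 1" using assms by (intro power_le_one) (auto simp: power2_eq_square mult_le_one)
  finally have "(1 - a) ^ T + (1 - a) ^ T * (a * real T) \<le> 1" by (simp add: algebra_simps)
  moreover have "(1 - a) ^ T \<ge> 0" using assms by simp
  ultimately have "(1 - a) ^ T * (a * real T) \<le> 1" by linarith
  then show ?thesis using assms by (simp add: field_simps)
qed

section \<open>The success property of a single stage\<close>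

context source
begin

text \<open>The interface between the coding argument and the arithmetic of phases. The bounds are
  uniform in the past \<open>w\<close> and the prescribed side \<open>s\<close>, which is what
  allows stages to be repeated.\<close>

definition stages :: "real \<Rightarrow> real \<Rightarrow> nat \<Rightarrow> bool" where
  "stages C c T \<longleftrightarrow> (\<forall>w\<in>lists {1..m}. \<forall>s. \<exists>B. complete_dict m B \<and>
    (\<forall>v\<in>B. real (length v) \<le> C * real T ^ 2) \<and>
    c / real T \<le> mean B (\<lambda>v. of_bool (near_integer s (3 / real T) (phase n p (w @ v)))))"

lemma letter_prob_bounds: obtains a where "0 < a" "a < 1" "\<And>i. i \<in> {1..m} \<Longrightarrow> a \<le> p i \<and> p i \<le> 1 - a"
proof
  let ?A = "p ` {1..m} \<union> (\<lambda>i. 1 - p i) ` {1..m}"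
  have ne: "?A \<noteq> {}" and fin: "finite ?A" using m by auto
  show "0 < Min ?A" using p_pos p_less_1 ne fin by (subst Min_gr_iff) force+
  show b: "Min ?A \<le> p i \<and> p i \<le> 1 - Min ?A" if "i \<in> {1..m}" for i
  proof -
    have "Min ?A \<le> p i" "Min ?A \<le> 1 - p i" using fin that by (auto intro!: Min_le)
    then show ?thesis by linarith
  qed
  have "1 \<in> {1..m}" using m by simp
  then show "Min ?A < 1" using b[of 1] p_less_1[of 1] by linarith
qed

lemma word_prob_le_power:
  assumes "\<And>i. i \<in> {1..m} \<Longrightarrow> p i \<le> b" "0 \<le> b"
  shows "w \<in> lists {1..m} \<Longrightarrow> word_prob p w \<le> b ^ length w"
proof (induction w)
  case (Cons i w)
  from Cons.prems have "i \<in> {1..m}" "w \<in> lists {1..m}" by simp_all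
  then have "p i * word_prob p w \<le> b * b ^ length w"
    using Cons.IH assms word_prob_pos[of w] by (intro mult_mono) auto
  then show ?case by simp
qed simp

text \<open>Take \<open>S\<close> as \<open>2 * T * ln T / c\<close> rounded up and use
  \<open>1 - x \<le> exp (- x)\<close>.\<close>

lemma exponential_hitting:
  assumes "0 < c" "c \<le> 1" "T \<ge> 2"
  shows "\<exists>S. (1 - c / real T) ^ S \<le> 1 / real T ^ 2 \<and> real S \<le> (2 / c + 1) * (real T * ln (real T))"
proof (intro exI conjI)
  let ?S = "nat \<lceil>2 * real T * ln (real T) / c\<rceil>"
  have pos: "2 * real T * ln (real T) / c \<ge> 0" using assms by simp
  have "(1 - c / real T) ^ ?S \<le> exp (- (c / real T)) ^ ?S"
    using exp_ge_add_one_self[of "- (c / real T)"] assms by (intro power_mono) (auto simp: field_simps)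
  also have "\<dots> = exp (- (c / real T * ?S))" by (simp add: exp_of_nat_mult[symmetric] mult.commute)
  also have "\<dots> \<le> exp (- (2 * ln (real T)))"
  proof -
    have "2 * ln (real T) = c / real T * (2 * real T * ln (real T) / c)" using assms by (simp add: field_simps)
    also have "\<dots> \<le> c / real T * ?S" using assms by (intro mult_left_mono real_nat_ceiling_ge) auto
    finally show ?thesis by simp
  qed
  also have "\<dots> = 1 / real T ^ 2"
    using assms by (simp add: exp_minus exp_double power2_eq_square divide_inverse)
  finally show "(1 - c / real T) ^ ?S \<le> 1 / real T ^ 2" .
  \<comment> \<open>For \<open>T \<ge> 2\<close> the product \<open>T * ln T\<close> exceeds 1 and
    absorbs the rounding of \<open>S\<close>; this is the \<open>+ 1\<close> in the
    constant.\<close>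
  have "ln 2 \<le> ln (real T)" using assms by simp
  then have "2 / 3 \<le> ln (real T)" using ln2_ge_two_thirds by linarith
  then have "2 * (2 / 3) \<le> real T * ln (real T)"
    using assms by (intro mult_mono) auto
  moreover have "real ?S \<le> 2 * real T * ln (real T) / c + 1" using pos by linarith
  ultimately show "real ?S \<le> (2 / c + 1) * (real T * ln (real T))" by (simp add: algebra_simps)
qed

end

section \<open>Balancing the signs of the rounding errors\<close>

context source
begin

definition rounding_error :: "nat \<Rightarrow> bool \<Rightarrow> nat list \<Rightarrow> real" where
  "rounding_error T s w = real (code_length s (3 / real T) (phase n p w)) - phase n p w"

definition bad :: "nat \<Rightarrow> bool \<Rightarrow> nat list \<Rightarrow> real" where
  "bad T s w = of_bool (\<not> near_integer s (3 / real T) (phase n p w))"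

text \<open>The relative error of \<open>n\<close> to the power minus code length as an
  approximation to the word probability. Its mean over a complete dictionary is the Kraft sum minus
  1.\<close>

definition kraft_excess :: "nat \<Rightarrow> bool \<Rightarrow> nat list \<Rightarrow> real" where
  "kraft_excess T s w = n powr - rounding_error T s w - 1"

lemma kraft_term:
  assumes "w \<in> lists {1..m}"
  shows "1 / real n ^ code_length s (3 / real T) (phase n p w) = word_prob p w * (1 + kraft_excess T s w)"
proof -
  have "word_prob p w * (1 + kraft_excess T s w)
      = n powr - phase n p w * n powr (phase n p w - real (code_length s (3 / real T) (phase n p w)))"
    using word_prob_eq_powr_phase[OF assms] by (simp add: kraft_excess_def rounding_error_def)
  also have "\<dots> = n powr - real (code_length s (3 / real T) (phase n p w))"
    by (simp flip: powr_add)
  also have "\<dots> = 1 / real n ^ code_length s (3 / real T) (phase n p w)"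
    using n by (simp add: powr_minus powr_realpow divide_inverse)
  finally show ?thesis ..
qed

text \<open>With code lengths rounded on side \<open>s\<close>, a good word has excess of order
  \<open>1/T\<close> with the sign belonging to \<open>s\<close>. A bad word is rounded up, so its
  excess lies between -1 and 0 and costs at most the term \<open>bad\<close>. The last bound is the
  second-order expansion: the linear part of the error is the negative excess, up to order
  \<open>1/T\<close> squared.\<close>

lemma
  assumes w: "w \<in> lists {1..m}" and T: "T \<ge> 2"
  defines "K \<equiv> 3 * ln (real n) * real n ^ 3"
  shows kraft_excess_True: "- (3 * ln (real n) / real T) - bad T True w \<le> kraft_excess T True w"
      "kraft_excess T True w \<le> 0"
    and kraft_excess_False: "- bad T False w \<le> kraft_excess T False w"
      "kraft_excess T False w \<le> K / real T"
    and rounding_error_le: "ln (real n) * rounding_error T s w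
      \<le> - kraft_excess T s w + 9 * (ln (real n))\<^sup>2 * real n ^ 3 / (real T)\<^sup>2 + ln (real n) * bad T s w"
proof -
  let ?g = "3 / real T"
  have ln: "ln (real n) > 0" using n by simp
  have g: "0 < ?g" "?g \<le> 3" using T by (auto simp: field_simps)
  have y: "phase n p w \<ge> 0" using w by (rule phase_nonneg)
  have exc: "kraft_excess T s w = exp (- (ln (real n) * rounding_error T s w)) - 1" for s
    using n by (simp add: kraft_excess_def powr_def mult.commute)
  have n3: "exp (3 * ln (real n)) = real n ^ 3"
    using n by (simp add: exp_of_nat_mult[of 3 "ln (real n)", simplified])
  have bad0: "near_integer s ?g (phase n p w) \<Longrightarrow> bad T s w = 0"
    and bad1: "\<not> near_integer s ?g (phase n p w) \<Longrightarrow> bad T s w = 1" for s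
    by (simp_all add: bad_def)
  have good_True: "0 \<le> rounding_error T True w" "rounding_error T True w \<le> ?g"
    if "near_integer True ?g (phase n p w)"
    using code_length_bounds(1)[OF y that] by (auto simp: rounding_error_def)
  have good_False: "- ?g \<le> rounding_error T False w" "rounding_error T False w \<le> 0"
    if "near_integer False ?g (phase n p w)"
    using code_length_bounds(2)[OF y that] by (auto simp: rounding_error_def)
  have not_good: "0 \<le> rounding_error T s w" "rounding_error T s w \<le> 1"
    if "\<not> near_integer s ?g (phase n p w)" for s
    using code_length_bounds(3)[OF y that] by (auto simp: rounding_error_def)
  have exc_le_0: "kraft_excess T s w \<le> 0" if "0 \<le> rounding_error T s w" for s
    using ln that by (simp add: exc)
  have exc_ge: "- (ln (real n) * rounding_error T s w) \<le> kraft_excess T s w" for s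
    using exp_ge_add_one_self[of "- (ln (real n) * rounding_error T s w)"] by (simp add: exc)
  have exc_ge_1: "- 1 \<le> kraft_excess T s w" for s by (simp add: exc)
  show "kraft_excess T True w \<le> 0"
    using exc_le_0 good_True(1) not_good(1) by blast
  show "- (3 * ln (real n) / real T) - bad T True w \<le> kraft_excess T True w"
  proof (cases "near_integer True ?g (phase n p w)")
    case True
    have "ln (real n) * rounding_error T True w \<le> ln (real n) * ?g"
      using good_True(2)[OF True] ln by (intro mult_left_mono) auto
    then show ?thesis using exc_ge[of True] bad0[OF True] by (simp add: mult.commute)
  next
    case False
    moreover have "0 \<le> 3 * ln (real n) / T" using ln by simp
    ultimately show ?thesis using exc_ge_1[of True] bad1[of True] by linarith
  qed
  show "- bad T False w \<le> kraft_excess T False w"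
  proof (cases "near_integer False ?g (phase n p w)")
    case True
    have "ln (real n) * rounding_error T False w \<le> 0"
      using good_False(2)[OF True] ln by (simp add: mult_nonneg_nonpos)
    then show ?thesis using exc_ge[of False] bad0[OF True] by simp
  next
    case False
    then show ?thesis using exc_ge_1[of False] bad1[OF False] by simp
  qed
  show "kraft_excess T False w \<le> K / real T"
  proof (cases "near_integer False ?g (phase n p w)")
    case True
    \<comment> \<open>Since \<open>3 / T \<le> 3\<close>, the exponent \<open>v\<close> is at most
      \<open>3 * ln n\<close>; then \<open>exp v - 1 \<le> v * exp v\<close> produces the factor
      \<open>n ^ 3\<close> in \<open>K\<close>.\<close>
    define v where "v = - (ln (real n) * rounding_error T False w)"
    have v0: "0 \<le> v" using good_False(2)[OF True] ln by (simp add: v_def mult_nonneg_nonpos)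
    have vg: "v \<le> ln (real n) * ?g"
      using mult_left_mono[of "- rounding_error T False w" ?g "ln (real n)"] good_False(1)[OF True] ln
      by (simp add: v_def)
    have "ln (real n) * ?g \<le> ln (real n) * 3" using g ln by (intro mult_left_mono) auto
    then have v3: "v \<le> 3 * ln (real n)" using vg by linarith
    have "exp v * (1 - v) \<le> exp v * exp (- v)"
      using exp_ge_add_one_self[of "- v"] by (intro mult_left_mono) auto
    then have "exp v - 1 \<le> v * exp v" by (simp add: exp_minus algebra_simps)
    also have "\<dots> \<le> (ln (real n) * ?g) * real n ^ 3"
      unfolding n3[symmetric] using v0 vg v3 by (intro mult_mono) auto
    finally show ?thesis by (simp add: exc v_def K_def mult.commute)
  next
    case False
    then have "kraft_excess T False w \<le> 0" using exc_le_0 not_good(1) by blast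
    also have "0 \<le> K / real T" unfolding K_def using ln by simp
    finally show ?thesis .
  qed
  show "ln (real n) * rounding_error T s w
      \<le> - kraft_excess T s w + 9 * (ln (real n))\<^sup>2 * real n ^ 3 / (real T)\<^sup>2 + ln (real n) * bad T s w"
  proof (cases "near_integer s ?g (phase n p w)")
    case True
    let ?u = "ln (real n) * rounding_error T s w"
    have e: "\<bar>rounding_error T s w\<bar> \<le> ?g"
      using good_True good_False True by (cases s) force+
    from mult_left_mono[OF this, of "ln (real n)"] have u: "\<bar>?u\<bar> \<le> ln (real n) * ?g"
      using ln by (simp add: abs_mult)
    have "ln (real n) * ?g \<le> ln (real n) * 3" using g ln by (intro mult_left_mono) auto
    then have u3: "\<bar>?u\<bar> \<le> 3 * ln (real n)" using u by linarith
    have "?u\<^sup>2 \<le> (ln (real n) * ?g)\<^sup>2" using u by (metis abs_ge_zero power2_abs power_mono)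
    then have "?u\<^sup>2 * exp (3 * ln (real n)) \<le> (ln (real n) * ?g)\<^sup>2 * exp (3 * ln (real n))"
      by (intro mult_right_mono) auto
    also have "\<dots> = 9 * (ln (real n))\<^sup>2 * real n ^ 3 / (real T)\<^sup>2"
      unfolding n3 by (simp add: power_mult_distrib power_divide)
    finally show ?thesis
      using exp_minus_le_quadratic[OF u3] bad0[OF True] by (simp add: exc)
  next
    case False
    have "ln (real n) * rounding_error T s w \<le> ln (real n) * 1"
      using not_good[OF False] ln by (intro mult_left_mono) auto
    moreover have "kraft_excess T s w \<le> 0" using exc_le_0 not_good[OF False] by blast
    moreover have "0 \<le> 9 * (ln (real n))\<^sup>2 * real n ^ 3 / (real T)\<^sup>2" by simp
    ultimately show ?thesis unfolding bad1[OF False] by linarith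
  qed
qed


section \<open>Assembling the dictionary and the code\<close>

lemma two_words:
  assumes W: "complete_dict m W" and ne: "[] \<notin> W"
  obtains a b where "a \<in> W" "b \<in> W" "a \<noteq> b"
proof -
  have "\<exists>w\<in>W. hd w = i" if i: "i \<in> {1..m}" for i
  proof -
    \<comment> \<open>The constant message of letter \<open>i\<close> must start with a dictionary
      word, so every letter begins some word.\<close>
    have "sconst i \<in> streams {1..m}" using i by (simp add: streams_iff_sset)
    from complete_dict_prefix_stream[OF W this]
    obtain w y where w: "w \<in> W" "sconst i = w @- y" by blast
    then have "shd (sconst i) = hd w" using ne by (cases w) auto
    then have "hd w = i" by simp
    with w show ?thesis by blast
  qed
  from this[of 1] this[of 2] m obtain a b where "a \<in> W" "b \<in> W" "hd a = 1" "hd b = 2" by auto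
  moreover from this have "a \<noteq> b" by force
  ultimately show thesis using that by blast
qed

text \<open>Repeats stages of length \<open>C * T ^ 2\<close> and success probability
  \<open>c / T\<close>. The mean length is their quotient, and order \<open>T * ln T\<close> stages
  push the failure probability below \<open>1 / T ^ 2\<close>.\<close>

lemma hitting_dictionary:
  assumes C: "0 \<le> C" and c: "0 < c" "c \<le> 1" and T: "T \<ge> 2" and st: "stages C c T"
    and w: "w \<in> lists {1..m}"
  shows "\<exists>D. complete_dict m D \<and>
    (\<forall>v\<in>D. real (length v) \<le> C * (2 / c + 1) * (real T ^ 3 * ln (real T))) \<and>
    mean D (\<lambda>v. real (length v)) \<le> C / c * real T ^ 3 \<and>
    mean D (\<lambda>v. bad T s (w @ v)) \<le> 1 / real T ^ 2"
proof -
  obtain S where S: "(1 - c / real T) ^ S \<le> 1 / real T ^ 2"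
      "real S \<le> (2 / c + 1) * (real T * ln (real T))"
    using exponential_hitting[OF c T] by blast
  let ?P = "\<lambda>w B. complete_dict m B \<and> (\<forall>v\<in>B. real (length v) \<le> C * real T ^ 2) \<and>
    c / real T \<le> mean B (\<lambda>v. of_bool (near_integer s (3 / real T) (phase n p (w @ v))))"
  have "\<forall>w\<in>lists {1..m}. \<exists>B. ?P w B" using st unfolding stages_def by blast
  from bchoice[OF this] obtain B where "\<forall>w\<in>lists {1..m}. ?P w (B w)" ..
  then obtain D where D: "complete_dict m D" "\<forall>v\<in>D. real (length v) \<le> C * real T ^ 2 * S"
      "mean D (\<lambda>v. real (length v)) \<le> C * real T ^ 2 / (c / real T)"
      "mean D (\<lambda>v. of_bool (\<not> near_integer s (3 / real T) (phase n p (w @ v)))) \<le> (1 - c / real T) ^ S"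
    using repeat_stages[of B "C * real T ^ 2" "c / real T" "\<lambda>w. near_integer s (3 / real T) (phase n p w)" w S]
      c C T w by (auto simp: field_simps)
  have "C * real T ^ 2 * S \<le> C * real T ^ 2 * ((2 / c + 1) * (real T * ln (real T)))"
    using C by (intro mult_left_mono S(2)) simp
  also have "\<dots> = C * (2 / c + 1) * (real T ^ 3 * ln (real T))" by (simp only: power2_eq_square power3_eq_cube mult.assoc mult.left_commute mult.commute)
  finally have "\<forall>v\<in>D. real (length v) \<le> C * (2 / c + 1) * (real T ^ 3 * ln (real T))"
    using D(2) by (meson order_trans)
  moreover have "C * real T ^ 2 / (c / real T) = C / c * real T ^ 3" by (simp add: power2_eq_square power3_eq_cube)
  moreover have "mean D (\<lambda>v. bad T s (w @ v)) \<le> 1 / real T ^ 2"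
    using D(4) S(1) unfolding bad_def by linarith
  ultimately show ?thesis using D(1,3) by metis
qed

text \<open>Each word of the first \<open>T\<close> letters receives one side for all its
  continuations. Its probability and the mean excess of its continuations are both of order
  \<open>1/T\<close>, so a single choice moves the Kraft sum by order \<open>1/T\<close> squared,
  and the greedy choice keeps the total within that order.\<close>

lemma balanced_dictionary:
  assumes C: "0 \<le> C" and c: "0 < c" "c \<le> 1"
  shows "\<exists>K>0. \<forall>T\<ge>2. stages C c T \<longrightarrow> (\<exists>W \<sigma>. complete_dict m W \<and>
    (\<forall>w\<in>W. T \<le> length w \<and> real (length w) \<le> K * (real T ^ 3 * ln (real T))) \<and>
    mean W (\<lambda>w. real (length w)) \<le> K * real T ^ 3 \<and>
    mean W (\<lambda>w. bad T (\<sigma> w) w) \<le> 1 / real T ^ 2 \<and>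
    - (K / real T ^ 2) \<le> mean W (\<lambda>w. kraft_excess T (\<sigma> w) w) \<and>
    mean W (\<lambda>w. kraft_excess T (\<sigma> w) w) \<le> 0)"
proof -
  obtain a where a: "0 < a" "a < 1" "\<And>i. i \<in> {1..m} \<Longrightarrow> a \<le> p i \<and> p i \<le> 1 - a"
    by (rule letter_prob_bounds) blast
  have ln_n: "ln (real n) > 0" using n by simp
  \<comment> \<open>\<open>K0 / T\<close> bounds the conditional mean excess in absolute value for
    both sides; the \<open>+ 1\<close> covers the bad words, of probability at most
    \<open>1 / T ^ 2\<close>.\<close>
  define K0 where "K0 = 3 * ln (real n) * real n ^ 3 + 1"
  have K0: "0 < K0" using ln_n by (simp add: K0_def add_nonneg_pos)
  \<comment> \<open>The three summands serve the maximum length, the mean length and the lower bound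
    on the Kraft sum.\<close>
  define K where "K = (2 + C * (2 / c + 1)) + (1 + C / c) + (2 * K0 / a + 1)"
  have K_parts: "2 + C * (2 / c + 1) \<le> K" "1 + C / c \<le> K" "2 * K0 / a + 1 \<le> K" "0 < K"
    using C c K0 a by (auto simp: K_def add_nonneg_nonneg add_nonneg_pos)
  show ?thesis
  proof (intro exI[of _ K] conjI allI impI)
    fix T :: nat assume T: "2 \<le> T" and st: "stages C c T"
    have T1: "1 \<le> real T" using T by simp
    have lnT: "1 / 2 \<le> ln (real T)"
    proof -
      have "ln 2 \<le> ln (real T)" using T by simp
      then show ?thesis using ln2_ge_two_thirds by linarith
    qed
    have T_le: "real T \<le> real T ^ 3" using T1 by (simp add: power_increasing[of 1 3 "real T", simplified])
    have T_le2: "real T \<le> 2 * (real T ^ 3 * ln (real T))"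
    proof -
      have "real T ^ 3 * (1 / 2) \<le> real T ^ 3 * ln (real T)" using lnT by (intro mult_left_mono) auto
      then show ?thesis using T_le by linarith
    qed
    define W0 where "W0 = {w \<in> lists {1..m}. length w = T}"
    have W0: "complete_dict m W0" unfolding W0_def by (rule complete_dict_length)
    let ?P = "\<lambda>(w, s) D. complete_dict m D \<and>
      (\<forall>v\<in>D. real (length v) \<le> C * (2 / c + 1) * (real T ^ 3 * ln (real T))) \<and>
      mean D (\<lambda>v. real (length v)) \<le> C / c * real T ^ 3 \<and>
      mean D (\<lambda>v. bad T s (w @ v)) \<le> 1 / real T ^ 2"
    have "\<forall>x\<in>lists {1..m} \<times> UNIV. \<exists>D. ?P x D"
      using hitting_dictionary[OF C c T st] by auto
    from bchoice[OF this] obtain D' where D': "\<forall>x\<in>lists {1..m} \<times> UNIV. ?P x (D' x)" ..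
    define D where "D w s = D' (w, s)" for w s
    have in_lists: "w \<in> lists {1..m}" if "w \<in> W0" for w using that by (simp add: W0_def)
    have "?P (w, s) (D w s)" if "w \<in> W0" for w s
      using bspec[OF D', of "(w, s)"] in_lists[OF that] unfolding D_def by blast
    then have D: "complete_dict m (D w s)"
      and D_len: "v \<in> D w s \<Longrightarrow> real (length v) \<le> C * (2 / c + 1) * (real T ^ 3 * ln (real T))"
      and D_avg: "mean (D w s) (\<lambda>v. real (length v)) \<le> C / c * real T ^ 3"
      and D_bad: "mean (D w s) (\<lambda>v. bad T s (w @ v)) \<le> 1 / real T ^ 2"
      if "w \<in> W0" for w s v
      using that by auto
    have in_lists2: "w @ v \<in> lists {1..m}" if "w \<in> W0" "v \<in> D w s" for w v s
      using complete_dict_lists[OF D[OF that(1)], of s] that in_lists[OF that(1)] by auto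
    have W0_length: "length w = T" if "w \<in> W0" for w using that by (simp add: W0_def)
    \<comment> \<open>The contribution of all continuations of \<open>w\<close> to the Kraft sum
      minus 1, if side \<open>s\<close> is chosen for \<open>w\<close>.\<close>
    define f where "f w s = word_prob p w * mean (D w s) (\<lambda>v. kraft_excess T s (w @ v))" for w s
    have T2: "1 / real T ^ 2 \<le> 1 / real T" using T1 by (simp add: field_simps power2_eq_square)
    have prob: "0 < word_prob p w" "word_prob p w \<le> 1 / (a * real T)" if "w \<in> W0" for w
    proof -
      show "0 < word_prob p w" using in_lists[OF that] by (rule word_prob_pos)
      have "word_prob p w \<le> (1 - a) ^ T"
        using word_prob_le_power[of "1 - a" w] a that by (auto simp: W0_def)
      also have "\<dots> \<le> 1 / (a * real T)" using a T by (intro power_le_inverse_linear) auto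
      finally show "word_prob p w \<le> 1 / (a * real T)" .
    qed
    have scale: "word_prob p w * (K0 / real T) \<le> K0 / (a * real T ^ 2)" if "w \<in> W0" for w
    proof -
      have "word_prob p w * (K0 / real T) \<le> 1 / (a * real T) * (K0 / real T)"
        using prob[OF that] K0 by (intro mult_right_mono) auto
      then show ?thesis by (simp add: power2_eq_square field_simps)
    qed
    have f_True: "- (K0 / (a * real T ^ 2)) \<le> f w True \<and> f w True \<le> 0" if w: "w \<in> W0" for w
    proof
      have "3 * ln (real n) * 1 \<le> 3 * ln (real n) * real n ^ 3"
        using ln_n n by (intro mult_left_mono one_le_power) auto
      then have "(3 * ln (real n) + 1) / real T \<le> K0 / real T"
        unfolding K0_def by (intro divide_right_mono) auto
      then have "- (K0 / real T) \<le> - (3 * ln (real n) / real T) - 1 / real T"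
        unfolding add_divide_distrib by linarith
      also have "\<dots> \<le> - (3 * ln (real n) / real T) - mean (D w True) (\<lambda>v. bad T True (w @ v))"
        using D_bad[OF w, of True] T2 by linarith
      also have "\<dots> = mean (D w True) (\<lambda>v. - (3 * ln (real n) / real T) - bad T True (w @ v))"
        by (simp only: mean_diff mean_const[OF D[OF w]])
      also have "\<dots> \<le> mean (D w True) (\<lambda>v. kraft_excess T True (w @ v))"
        by (intro mean_mono D[OF w] kraft_excess_True(1)[OF in_lists2[OF w] T])
      finally have "word_prob p w * - (K0 / real T) \<le> f w True"
        unfolding f_def using prob[OF w] by (intro mult_left_mono) auto
      then show "- (K0 / (a * real T ^ 2)) \<le> f w True" using scale[OF w] by simp
      have "mean (D w True) (\<lambda>v. kraft_excess T True (w @ v)) \<le> mean (D w True) (\<lambda>_. 0)"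
        by (intro mean_mono D[OF w] kraft_excess_True(2)[OF in_lists2[OF w] T])
      then show "f w True \<le> 0"
        unfolding f_def using prob[OF w] mean_const[OF D[OF w]] by (simp add: mult_nonneg_nonpos)
    qed
    have f_False: "- (word_prob p w / real T ^ 2) \<le> f w False \<and> f w False \<le> K0 / (a * real T ^ 2) \<and>
      0 \<le> word_prob p w / real T ^ 2" if w: "w \<in> W0" for w
    proof (intro conjI)
      have "- (1 / real T ^ 2) \<le> mean (D w False) (\<lambda>v. - 1 * bad T False (w @ v))"
        unfolding mean_cmult using D_bad[OF w, of False] by simp
      also have "\<dots> \<le> mean (D w False) (\<lambda>v. kraft_excess T False (w @ v))"
        using kraft_excess_False(1)[OF in_lists2[OF w] T] by (intro mean_mono D[OF w]) simp
      finally have "word_prob p w * - (1 / real T ^ 2) \<le> f w False"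
        unfolding f_def using prob[OF w] by (intro mult_left_mono) auto
      then show "- (word_prob p w / real T ^ 2) \<le> f w False" by simp
      have "mean (D w False) (\<lambda>v. kraft_excess T False (w @ v)) \<le> mean (D w False) (\<lambda>_. K0 / real T)"
      proof (intro mean_mono D[OF w])
        fix v assume "v \<in> D w False"
        from kraft_excess_False(2)[OF in_lists2[OF w this] T]
        show "kraft_excess T False (w @ v) \<le> K0 / real T"
          by (rule order_trans) (simp add: K0_def divide_right_mono)
      qed
      then have "f w False \<le> word_prob p w * (K0 / real T)"
        unfolding f_def mean_const[OF D[OF w]] using prob[OF w] by (intro mult_left_mono) auto
      then show "f w False \<le> K0 / (a * real T ^ 2)" using scale[OF w] by simp
      show "0 \<le> word_prob p w / real T ^ 2" using prob[OF w] by simp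
    qed
    have "0 \<le> K0 / (a * real T ^ 2)" using K0 a by simp
    from greedy_signs[of W0 "K0 / (a * real T ^ 2)" f "\<lambda>w. word_prob p w / real T ^ 2",
        OF complete_dict_finite[OF W0] this] f_True f_False
    obtain s where s: "- (2 * (K0 / (a * real T ^ 2)) + (\<Sum>w\<in>W0. word_prob p w / real T ^ 2)) \<le> (\<Sum>w\<in>W0. f w (s w))"
        "(\<Sum>w\<in>W0. f w (s w)) \<le> 0" by blast
    have "(\<Sum>w\<in>W0. word_prob p w / real T ^ 2) = 1 / real T ^ 2"
      using mean_const[OF W0, of "1 / real T ^ 2"] by (simp add: dict_mean_def)
    then have "2 * (K0 / (a * real T ^ 2)) + (\<Sum>w\<in>W0. word_prob p w / real T ^ 2) = (2 * K0 / a + 1) / real T ^ 2"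
      by (simp add: add_divide_distrib)
    also have "\<dots> \<le> K / real T ^ 2" using K_parts(3) by (intro divide_right_mono) auto
    finally have s_lower: "- (K / real T ^ 2) \<le> (\<Sum>w\<in>W0. f w (s w))" using s(1) by linarith
    define W where "W = graft W0 (\<lambda>w. D w (s w))"
    \<comment> \<open>The side belonging to a dictionary word is recovered from its first
      \<open>T\<close> letters.\<close>
    define \<sigma> where "\<sigma> w = s (take T w)" for w
    have \<sigma>: "\<sigma> (w @ v) = s w" if "w \<in> W0" for w v using that by (simp add: \<sigma>_def W0_def)
    have mean_W: "mean W g = mean W0 (\<lambda>w. mean (D w (s w)) (\<lambda>v. g (w @ v)))" for g
      unfolding W_def using complete_dict_finite[OF D] by (rule dict_mean_graft[OF W0])
    have excess: "mean W (\<lambda>w. kraft_excess T (\<sigma> w) w) = (\<Sum>w\<in>W0. f w (s w))"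
      unfolding mean_W by (simp add: dict_mean_def[of p W0] f_def \<sigma>)
    have "complete_dict m W" unfolding W_def using D by (rule complete_dict_graft[OF W0])
    moreover have "\<forall>w\<in>W. T \<le> length w \<and> real (length w) \<le> K * (real T ^ 3 * ln (real T))"
    proof
      fix x assume "x \<in> W"
      then obtain w v where x: "x = w @ v" "w \<in> W0" "v \<in> D w (s w)" by (auto simp: W_def graft_def)
      then have len: "length x = T + length v" by (simp add: W0_def)
      have "real (length x) \<le> (2 + C * (2 / c + 1)) * (real T ^ 3 * ln (real T))"
        using len T_le2 D_len[OF x(2,3)] unfolding distrib_right[of 2] by simp
      also have "\<dots> \<le> K * (real T ^ 3 * ln (real T))"
        using K_parts(1) lnT by (intro mult_right_mono) auto
      finally show "T \<le> length x \<and> real (length x) \<le> K * (real T ^ 3 * ln (real T))" using len by simp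
    qed
    moreover have "mean W (\<lambda>w. real (length w)) \<le> K * real T ^ 3"
    proof -
      have "mean W (\<lambda>w. real (length w)) = mean W0 (\<lambda>w. real T + mean (D w (s w)) (\<lambda>v. real (length v)))"
        unfolding mean_W
        by (intro mean_cong) (simp add: W0_length mean_add mean_const[OF D])
      also have "\<dots> \<le> mean W0 (\<lambda>w. real T ^ 3 + C / c * real T ^ 3)"
        using T_le D_avg by (intro mean_mono W0 add_mono) auto
      also have "\<dots> = (1 + C / c) * real T ^ 3" by (simp add: mean_const[OF W0] algebra_simps)
      also have "\<dots> \<le> K * real T ^ 3" using K_parts(2) by (intro mult_right_mono) auto
      finally show ?thesis .
    qed
    moreover have "mean W (\<lambda>w. bad T (\<sigma> w) w) \<le> 1 / real T ^ 2"
    proof -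
      have "mean W (\<lambda>w. bad T (\<sigma> w) w) = mean W0 (\<lambda>w. mean (D w (s w)) (\<lambda>v. bad T (s w) (w @ v)))"
        unfolding mean_W by (intro mean_cong) (simp add: \<sigma>)
      also have "\<dots> \<le> mean W0 (\<lambda>w. 1 / real T ^ 2)" by (intro mean_mono W0 D_bad)
      finally show ?thesis by (simp add: mean_const[OF W0])
    qed
    ultimately show "\<exists>W \<sigma>. complete_dict m W \<and>
      (\<forall>w\<in>W. T \<le> length w \<and> real (length w) \<le> K * (real T ^ 3 * ln (real T))) \<and>
      mean W (\<lambda>w. real (length w)) \<le> K * real T ^ 3 \<and>
      mean W (\<lambda>w. bad T (\<sigma> w) w) \<le> 1 / real T ^ 2 \<and>
      - (K / real T ^ 2) \<le> mean W (\<lambda>w. kraft_excess T (\<sigma> w) w) \<and>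
      mean W (\<lambda>w. kraft_excess T (\<sigma> w) w) \<le> 0"
      using s(2) s_lower excess by (intro exI[of _ W] exI[of _ \<sigma>]) simp
  qed (rule K_parts)
qed


text \<open>A nonpositive mean excess is Kraft's inequality for the rounded phases, which gives a
  prefix code. The lower bound on the mean excess controls the linear part of the mean rounding
  error, and hence the redundancy.\<close>

lemma code_from_stages:
  assumes C: "0 \<le> C" and c: "0 < c" "c \<le> 1"
  shows "\<exists>K>0. \<forall>T\<ge>2. stages C c T \<longrightarrow> (\<exists>W \<phi>. word_code m n W \<phi> \<and> decipherable W \<phi> \<and>
    redundancy m n p W \<phi> \<le> K * inverse (average_delay p W) * inverse (real T ^ 2) \<and>
    average_delay p W \<le> K * real T ^ 3 \<and>
    real (max_delay W) \<le> K * real T ^ 3 * ln (real T))"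
proof -
  obtain K0 where K0: "K0 > 0" and bal: "\<And>T. T \<ge> 2 \<Longrightarrow> stages C c T \<Longrightarrow> \<exists>W \<sigma>. complete_dict m W \<and>
      (\<forall>w\<in>W. T \<le> length w \<and> real (length w) \<le> K0 * (real T ^ 3 * ln (real T))) \<and>
      mean W (\<lambda>w. real (length w)) \<le> K0 * real T ^ 3 \<and>
      mean W (\<lambda>w. bad T (\<sigma> w) w) \<le> 1 / real T ^ 2 \<and>
      - (K0 / real T ^ 2) \<le> mean W (\<lambda>w. kraft_excess T (\<sigma> w) w) \<and>
      mean W (\<lambda>w. kraft_excess T (\<sigma> w) w) \<le> 0"
    using balanced_dictionary[OF C c] by blast
  have ln_n: "ln (real n) > 0" using n by simp
  \<comment> \<open>The three summands come from the slack in the Kraft sum, the quadratic remainder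
    and the bad words.\<close>
  define \<Lambda> where "\<Lambda> = K0 + 9 * (ln (real n))\<^sup>2 * real n ^ 3 + ln (real n)"
  define K where "K = K0 + \<Lambda> / ln (real n)"
  have \<Lambda>: "0 < \<Lambda>" unfolding \<Lambda>_def using K0 ln_n by (intro add_pos_pos add_pos_nonneg) auto
  have K: "K0 \<le> K" "\<Lambda> \<le> ln (real n) * K" "0 < K"
    using \<Lambda> K0 ln_n by (simp_all add: K_def distrib_left add_pos_pos)
  show ?thesis
  proof (intro exI[of _ K] conjI allI impI)
    fix T :: nat assume T: "2 \<le> T" and st: "stages C c T"
    obtain W \<sigma> where W: "complete_dict m W"
      and long: "\<And>w. w \<in> W \<Longrightarrow> T \<le> length w"
      and len: "\<And>w. w \<in> W \<Longrightarrow> real (length w) \<le> K0 * (real T ^ 3 * ln (real T))"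
      and avg: "mean W (\<lambda>w. real (length w)) \<le> K0 * real T ^ 3"
      and bad: "mean W (\<lambda>w. bad T (\<sigma> w) w) \<le> 1 / real T ^ 2"
      and lower: "- (K0 / real T ^ 2) \<le> mean W (\<lambda>w. kraft_excess T (\<sigma> w) w)"
      and upper: "mean W (\<lambda>w. kraft_excess T (\<sigma> w) w) \<le> 0"
      using bal[OF T st] by blast
    have ne: "[] \<notin> W" using long[of "[]"] T by auto
    have fin: "finite W" using W by (rule complete_dict_finite)
    have in_lists: "w \<in> lists {1..m}" if "w \<in> W" for w using complete_dict_lists[OF W] that by blast
    obtain a b where ab: "a \<in> W" "b \<in> W" "a \<noteq> b" using two_words[OF W ne] .
    define l where "l w = code_length (\<sigma> w) (3 / real T) (phase n p w)" for w
    have "(\<Sum>w\<in>W. 1 / real n ^ l w) = mean W (\<lambda>w. 1 + kraft_excess T (\<sigma> w) w)"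
      unfolding dict_mean_def l_def using kraft_term in_lists by (intro sum.cong) auto
    also have "\<dots> \<le> 1" using upper by (simp add: mean_add mean_const[OF W])
    finally have "(\<Sum>w\<in>W. 1 / real n ^ l w) \<le> 1" .
    moreover have "n > 0" using n by simp
    ultimately obtain \<phi> where \<phi>: "\<And>w. w \<in> W \<Longrightarrow> \<phi> w \<in> lists {1..n}"
        "\<And>w. w \<in> W \<Longrightarrow> length (\<phi> w) = l w"
      and free: "\<And>w w' u u'. w \<in> W \<Longrightarrow> w' \<in> W \<Longrightarrow> w \<noteq> w' \<Longrightarrow> \<phi> w @ u \<noteq> \<phi> w' @ u'"
      using kraft_prefix_code[OF fin, of n l] by blast
    have "decipherable W \<phi>" using free ab by (rule prefix_free_decipherable)
    moreover have "word_code m n W \<phi>"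
      unfolding word_code_def using message_dictionary_complete[OF W ne] \<phi>(1) by blast
    moreover have avg_eq: "average_delay p W = mean W (\<lambda>w. real (length w))"
      by (simp add: average_delay_def dict_mean_def)
    have avg_pos: "0 < average_delay p W"
    proof -
      have "mean W (\<lambda>_. 2) \<le> mean W (\<lambda>w. real (length w))"
        using long T by (intro mean_mono W) (metis of_nat_mono of_nat_numeral order_trans)
      then show ?thesis by (simp add: avg_eq mean_const[OF W])
    qed
    have "average_delay p W \<le> K * real T ^ 3"
      unfolding avg_eq using avg by (rule order_trans) (use K in \<open>simp add: mult_right_mono\<close>)
    moreover have "real (max_delay W) \<le> K * real T ^ 3 * ln (real T)"
    proof -
      have "max_delay W \<in> length ` W" unfolding max_delay_def using fin ab by (intro Max_in) auto
      then obtain w where "w \<in> W" "max_delay W = length w" by auto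
      then have "real (max_delay W) \<le> K0 * (real T ^ 3 * ln (real T))" using len by simp
      also have "\<dots> \<le> K * (real T ^ 3 * ln (real T))"
        using T K by (intro mult_right_mono) auto
      finally show ?thesis by (simp add: mult.assoc)
    qed
    moreover have "redundancy m n p W \<phi> \<le> K * inverse (average_delay p W) * inverse (real T ^ 2)"
    proof -
      \<comment> \<open>Code length is phase plus rounding error. Wald's identity makes the mean
        phase cancel the entropy term, leaving the mean error divided by the average delay.\<close>
      let ?e = "\<lambda>w. rounding_error T (\<sigma> w) w"
      have "(\<Sum>w\<in>W. word_prob p w * real (length (\<phi> w))) = mean W (\<lambda>w. ?e w + phase n p w)"
        unfolding dict_mean_def using \<phi>(2)
        by (intro sum.cong) (auto simp: rounding_error_def l_def)
      also have "\<dots> = mean W ?e + source_entropy m p / log 2 n * average_delay p W"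
        by (simp add: mean_add mean_phase[OF W] avg_eq)
      finally have red: "redundancy m n p W \<phi> = inverse (average_delay p W) * mean W ?e"
        unfolding redundancy_def using avg_pos by (simp add: distrib_left)
      have "ln (real n) * mean W ?e \<le> mean W (\<lambda>w. - 1 * kraft_excess T (\<sigma> w) w
          + 9 * (ln (real n))\<^sup>2 * real n ^ 3 / (real T)\<^sup>2 + ln (real n) * bad T (\<sigma> w) w)"
        unfolding mean_cmult[symmetric]
        using rounding_error_le[OF in_lists T] by (intro mean_mono W) simp
      also have "\<dots> = - mean W (\<lambda>w. kraft_excess T (\<sigma> w) w)
          + 9 * (ln (real n))\<^sup>2 * real n ^ 3 / (real T)\<^sup>2 + ln (real n) * mean W (\<lambda>w. bad T (\<sigma> w) w)"
        by (simp only: mean_add mean_cmult mean_const[OF W])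
      also have "\<dots> \<le> K0 / real T ^ 2 + 9 * (ln (real n))\<^sup>2 * real n ^ 3 / (real T)\<^sup>2
          + ln (real n) * (1 / real T ^ 2)"
        using lower mult_left_mono[OF bad, of "ln (real n)"] ln_n by (intro add_mono) auto
      also have "\<dots> = \<Lambda> / real T ^ 2" by (simp add: \<Lambda>_def add_divide_distrib)
      also have "\<dots> \<le> ln (real n) * K / real T ^ 2" using K(2) by (intro divide_right_mono) auto
      finally have "mean W ?e \<le> K / real T ^ 2" using ln_n by (simp flip: times_divide_eq_right)
      from mult_left_mono[OF this, of "inverse (average_delay p W)"]
      show ?thesis unfolding red using avg_pos by (simp add: divide_inverse mult_ac)
    qed
    ultimately show "\<exists>W \<phi>. word_code m n W \<phi> \<and> decipherable W \<phi> \<and>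
      redundancy m n p W \<phi> \<le> K * inverse (average_delay p W) * inverse (real T ^ 2) \<and>
      average_delay p W \<le> K * real T ^ 3 \<and>
      real (max_delay W) \<le> K * real T ^ 3 * ln (real T)" by blast
  qed (rule K)
qed

end

section \<open>Diophantine and negative binomial estimates\<close>

text \<open>As \<open>a\<close> is invertible modulo \<open>q\<close>, the multiples
  \<open>j * a / q\<close> with \<open>j < q\<close> run through all multiples of
  \<open>1 / q\<close> modulo 1. Replacing \<open>a / q\<close> by \<open>\<theta>\<close> shifts
  each by at most \<open>1 / q\<close>.\<close>

lemma dense_window:
  fixes \<theta> z u :: real and a q :: int
  assumes q: "q > 0" and cop: "coprime a q" and appr: "\<bar>\<theta> - of_int a / of_int q\<bar> < 1 / (of_int q)\<^sup>2"
  shows "\<exists>j<nat q. \<exists>h::int. u \<le> z + real j * \<theta> + of_int h \<and> z + real j * \<theta> + of_int h \<le> u + 3 / of_int q"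
proof -
  \<comment> \<open>The \<open>+ 1\<close> puts \<open>N / q\<close> between
    \<open>u - z + 1 / q\<close> and \<open>u - z + 2 / q\<close>, leaving a margin of
    \<open>1 / q\<close> on both sides for the approximation error. This is why the window has
    length \<open>3 / q\<close>.\<close>
  define N where "N = \<lceil>of_int q * (u - z)\<rceil> + 1"
  define \<delta> where "\<delta> = \<theta> - of_int a / of_int q"
  obtain x y where xy: "x * a + y * q = 1" using bezout_int[of a q] cop by auto
  \<comment> \<open>By the Bezout identity \<open>x\<close> inverts \<open>a\<close> modulo
    \<open>q\<close>, so \<open>a * i\<close> is congruent to \<open>N\<close>; \<open>t\<close> is
    the quotient.\<close>
  define i where "i = (x * N) mod q"
  define t where "t = - (y * N) - a * ((x * N) div q)"
  have "i = x * N - q * ((x * N) div q)" by (simp add: i_def minus_mult_div_eq_mod)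
  then have "a * i = a * (x * N - q * ((x * N) div q))" by simp
  also have "\<dots> = (x * a + y * q) * N + q * t" by (simp add: t_def algebra_simps)
  finally have t: "a * i = N + q * t" by (simp add: xy)
  have i: "0 \<le> i" "i < q" using q by (simp_all add: i_def)
  have "of_int i * \<bar>\<delta>\<bar> \<le> of_int q * (1 / (of_int q)\<^sup>2)"
    using appr i by (intro mult_mono) (auto simp: \<delta>_def)
  then have i\<delta>: "\<bar>of_int i * \<delta>\<bar> \<le> 1 / of_int q"
    using q i by (simp add: abs_mult power2_eq_square)
  have "of_int i * \<theta> = of_int (a * i) / of_int q + of_int i * \<delta>"
    by (simp add: \<delta>_def algebra_simps)
  also have "real_of_int (a * i) / of_int q = of_int N / of_int q + of_int t"
    using q by (simp add: t field_simps)
  finally have eq: "z + of_int i * \<theta> + of_int (- t) = z + of_int N / of_int q + of_int i * \<delta>" by simp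
  have N: "of_int q * (u - z) + 1 \<le> of_int N" "of_int N \<le> of_int q * (u - z) + 2"
    unfolding N_def by linarith+
  have "(of_int q * (u - z) + 1) / of_int q \<le> of_int N / of_int q"
    "of_int N / of_int q \<le> (of_int q * (u - z) + 2) / of_int q"
    using N q by (intro divide_right_mono; simp)+
  then have "u - z + 1 / of_int q \<le> of_int N / of_int q" "of_int N / of_int q \<le> u - z + 2 / of_int q"
    using q by (simp_all add: add_divide_distrib)
  moreover have "3 / real_of_int q = 2 / of_int q + 1 / of_int q" by (simp flip: add_divide_distrib)
  ultimately have "u \<le> z + of_int i * \<theta> + of_int (- t)" "z + of_int i * \<theta> + of_int (- t) \<le> u + 3 / of_int q"
    unfolding eq using i\<delta> by linarith+
  then show ?thesis using i by (intro exI[of _ "nat i"] conjI exI[of _ "- t"]) auto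
qed

text \<open>The ratio \<open>f (k + 1) / f k\<close> equals
  \<open>(1 - s) * (k + R) / (k + 1)\<close>, which is at least 1 exactly when
  \<open>s * k \<le> (1 - s) * R - 1\<close>; so \<open>K0\<close> is a mode. In the
  \<open>q\<close> steps after it, the ratio stays above \<open>1 - 1 / (2 * q)\<close> once
  \<open>K0\<close> is of order \<open>q\<close> squared, so at most half of the mass is
  lost.\<close>

lemma
  fixes s :: real and R :: nat
  assumes s: "0 < s" "s < 1" and R: "R > 0" "(1 - s) * R \<ge> 1"
  defines "f \<equiv> pmf (neg_binomial_pmf R s)"
  defines "K0 \<equiv> nat \<lceil>((1 - s) * R - 1) / s\<rceil>"
  shows neg_binomial_mode: "f k \<le> f K0"
    and neg_binomial_near_mode: "2 * q\<^sup>2 \<le> K0 + 1 \<Longrightarrow> j \<le> q \<Longrightarrow> 0 < q \<Longrightarrow>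
      (1 - real j / (2 * real q)) * f K0 \<le> f (K0 + j)"
proof -
  obtain r where r: "R = Suc r" using R(1) by (cases R) auto
  have f: "f k = real ((k + r) choose k) * s ^ R * (1 - s) ^ k" for k
    unfolding f_def using s by (subst pmf_neg_binomial) (auto simp: r)
  have f_nonneg: "f k \<ge> 0" for k by (simp add: f_def)
  have rec: "real (Suc k) * f (Suc k) = (1 - s) * (real k + R) * f k" for k
  proof -
    have "real (Suc k) * f (Suc k)
        = (real (Suc (k + r) choose Suc k) * real (Suc k)) * (s ^ R * ((1 - s) * (1 - s) ^ k))"
      unfolding f by (simp only: add_Suc power_Suc mult_ac)
    also have "real (Suc (k + r) choose Suc k) * real (Suc k) = real (Suc (k + r)) * real ((k + r) choose k)"
      using Suc_times_binomial_eq[of "k + r" k] by (metis of_nat_mult)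
    finally have "real (Suc k) * f (Suc k)
        = real (Suc (k + r)) * real ((k + r) choose k) * (s ^ R * ((1 - s) * (1 - s) ^ k))" .
    moreover have "real (Suc (k + r)) = real k + R" by (simp add: r)
    ultimately show ?thesis unfolding f by (simp only: mult_ac)
  qed
  have K0: "(1 - s) * R - 1 \<le> s * K0" "s * K0 < (1 - s) * R - 1 + s"
  proof -
    let ?x = "((1 - s) * R - 1) / s"
    have x: "0 \<le> ?x" "s * ?x = (1 - s) * R - 1" using R s by (auto simp: field_simps)
    have "?x \<le> real K0" "real K0 < ?x + 1" unfolding K0_def using x(1) by linarith+
    then have "s * ?x \<le> s * K0" "s * K0 < s * (?x + 1)"
      using s by (intro mult_left_mono mult_strict_left_mono; linarith)+
    then show "(1 - s) * R - 1 \<le> s * K0" "s * K0 < (1 - s) * R - 1 + s"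
      unfolding distrib_left x(2) by simp_all
  qed
  have up: "f k \<le> f (Suc k)" if "k < K0" for k
  proof -
    have "s * real (Suc k) \<le> s * real K0" using that s by (intro mult_left_mono) auto
    then have "s * k + s \<le> s * K0" by (simp add: distrib_left)
    then have "real (Suc k) \<le> (1 - s) * (real k + R)" using K0(2) by (simp add: algebra_simps)
    from mult_right_mono[OF this f_nonneg[of k]] rec[of k]
    have "real (Suc k) * f k \<le> real (Suc k) * f (Suc k)" by simp
    then show ?thesis by simp
  qed
  have down: "f (Suc k) \<le> f k" if "k \<ge> K0" for k
  proof -
    have "s * real K0 \<le> s * real k" using that s by (intro mult_left_mono) auto
    then have "(1 - s) * (real k + R) \<le> real (Suc k)" using K0(1) by (simp add: algebra_simps)
    from mult_right_mono[OF this f_nonneg[of k]] rec[of k]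
    have "real (Suc k) * f (Suc k) \<le> real (Suc k) * f k" by simp
    then show ?thesis by simp
  qed
  show "f k \<le> f K0"
  proof (cases "k \<le> K0")
    case True
    then show ?thesis
    proof (induction rule: inc_induct)
      case (step k)
      then show ?case using up[of k] by simp
    qed simp
  next
    case False
    then have "K0 \<le> k" by simp
    then show ?thesis
    proof (induction rule: dec_induct)
      case (step k)
      then show ?case using down[of k] by simp
    qed simp
  qed
  show "(1 - real j / (2 * real q)) * f K0 \<le> f (K0 + j)"
    if q: "2 * q\<^sup>2 \<le> K0 + 1" "j \<le> q" "0 < q" using that(2)
  proof (induction j)
    case 0
    then show ?case by simp
  next
    case (Suc j)
    let ?k = "K0 + j"
    let ?t = "1 / (2 * real q)"
    have t: "0 < ?t" "?t \<le> 1" using q(3) by auto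
    have "s * real ?k \<le> s * K0 + j" using s by (simp add: distrib_left mult_left_le_one_le)
    then have "real (Suc ?k) - q \<le> (1 - s) * (real ?k + R)"
      using K0(2) s Suc.prems by (simp add: algebra_simps)
    moreover have "real q \<le> ?t * real (Suc ?k)"
    proof -
      have "real (2 * q\<^sup>2) \<le> real (Suc ?k)" using q(1) by (intro of_nat_mono) simp
      from mult_left_mono[OF this, of ?t] t show ?thesis using q(3) by (simp add: power2_eq_square)
    qed
    ultimately have "(1 - ?t) * real (Suc ?k) \<le> (1 - s) * (real ?k + R)"
      unfolding left_diff_distrib by simp
    from mult_right_mono[OF this f_nonneg[of ?k]] rec[of ?k]
    have "real (Suc ?k) * ((1 - ?t) * f ?k) \<le> real (Suc ?k) * f (Suc ?k)" by (simp add: mult_ac)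
    then have "(1 - ?t) * f ?k \<le> f (Suc ?k)" by simp
    moreover have "(1 - ?t) * ((1 - j * ?t) * f K0) \<le> (1 - ?t) * f ?k"
      using Suc t by (intro mult_left_mono) auto
    moreover have "(1 - Suc j * ?t) * f K0 \<le> (1 - ?t) * ((1 - j * ?t) * f K0)"
    proof -
      have "1 - Suc j * t \<le> (1 - t) * (1 - j * t)" for t :: real
        using mult_nonneg_nonneg[OF zero_le_square[of t], of "real j"] by (simp add: algebra_simps)
      from mult_right_mono[OF this[of ?t] f_nonneg[of K0]] show ?thesis by (simp only: mult.assoc)
    qed
    ultimately show ?case by simp
  qed
qed

lemma card_nat_interval_le:
  fixes \<mu> t :: real
  assumes "t \<ge> 0"
  shows "finite {x::nat. \<bar>real x - \<mu>\<bar> < t}" "real (card {x::nat. \<bar>real x - \<mu>\<bar> < t}) \<le> 2 * t + 1"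
proof -
  let ?A = "{x::nat. \<bar>real x - \<mu>\<bar> < t}"
  have "x \<le> nat \<lceil>\<mu> + t\<rceil>" if "x \<in> ?A" for x
    using that by simp linarith
  then have "?A \<subseteq> {..nat \<lceil>\<mu> + t\<rceil>}" by auto
  then show fin: "finite ?A" by (rule finite_subset) simp
  show "real (card ?A) \<le> 2 * t + 1"
  proof (cases "?A = {}")
    case False
    have "?A \<subseteq> {Min ?A..Max ?A}" using fin by auto
    then have "card ?A \<le> card {Min ?A..Max ?A}" by (intro card_mono) auto
    moreover have "Min ?A \<in> ?A" "Max ?A \<in> ?A"
      using Min_in[OF fin False] Max_in[OF fin False] .
    moreover from this have "Min ?A \<le> Max ?A" using Min_le[OF fin] by blast
    ultimately have "card ?A \<le> card {Min ?A..Max ?A}" and "real (card {Min ?A..Max ?A}) \<le> 2 * t + 1"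
      by (simp_all, linarith)
    then show ?thesis by linarith
  qed (use assms in auto)
qed

text \<open>At the time of the \<open>R\<close>-th success with \<open>R\<close> of order \<open>q\<^sup>2\<close>, the number of failures has fluctuations of
  order \<open>q\<close>. By concentration the mode carries mass of order \<open>1/q\<close>, and so do the \<open>q\<close> values after
  it.\<close>

lemma neg_binomial_local_lower_bound:
  fixes s :: real
  assumes s: "0 < s" "s < 1"
  shows "\<exists>C c. 0 \<le> C \<and> 0 < c \<and> (\<forall>q>0. \<exists>R K0::nat. real (R + K0) \<le> C * real q ^ 2 \<and>
    (\<forall>j\<le>q. c / real q \<le> pmf (neg_binomial_pmf R s) (K0 + j)))"
proof -
  \<comment> \<open>The number of successes will be \<open>R = N * q ^ 2\<close>. The first bound
    gives \<open>s * t \<le> R / 4\<close>, needed for the concentration inequality; the second puts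
    the mode beyond \<open>2 * q ^ 2\<close>.\<close>
  obtain N :: nat where N: "N \<ge> 12 / s" "N \<ge> 3 / (1 - s)"
    using real_arch_simple[of "max (12 / s) (3 / (1 - s))"] by auto
  have N_pos: "real N > 0" using N(1) s by (smt (verit) divide_pos_pos)
  \<comment> \<open>With radius \<open>t = \<tau> * q\<close> this makes
    \<open>s ^ 3 * t ^ 2\<close> equal to \<open>3 / 4 * R\<close>. The tail bound is then
    \<open>2 * exp (- 3 / 2)\<close>, below \<open>3 / 5\<close>, so the window around the mean
    \<open>\<mu>\<close> keeps mass at least \<open>2 / 5\<close>.\<close>
  define \<tau> where "\<tau> = sqrt (3 * real N / (4 * s ^ 3))"
  have \<tau>: "\<tau> > 0" using s N_pos by (simp add: \<tau>_def)
  have \<tau>2: "\<tau>\<^sup>2 = 3 * real N / (4 * s ^ 3)" using s N_pos by (simp add: \<tau>_def)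
  \<comment> \<open>The window has at most \<open>(2 * \<tau> + 1) * q\<close> integers, so the mode
    has mass at least \<open>2 * c / q\<close>; the factor 2 is spent on the values after the
    mode.\<close>
  define c where "c = (1 / 5) / (2 * \<tau> + 1)"
  have c: "c > 0" using \<tau> by (simp add: c_def)
  have main: "\<exists>R K0::nat. real (R + K0) \<le> (real N + real N / s + 1) * real q ^ 2 \<and>
    (\<forall>j\<le>q. c / real q \<le> pmf (neg_binomial_pmf R s) (K0 + j))" if q: "q > 0" for q :: nat
  proof (intro exI conjI allI impI)
    let ?R = "N * q\<^sup>2"
    let ?K0 = "nat \<lceil>((1 - s) * ?R - 1) / s\<rceil>"
    let ?f = "pmf (neg_binomial_pmf ?R s)"
    define t where "t = \<tau> * q"
    define \<mu> where "\<mu> = real ?R * (1 - s) / s"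
    have q1: "1 \<le> real q ^ 2" using q by (simp add: one_le_power)
    have R_pos: "?R > 0" using N_pos q by simp
    have R3: "3 * real q ^ 2 \<le> (1 - s) * ?R"
    proof -
      have "3 \<le> (1 - s) * N" using N(2) s by (simp add: field_simps)
      from mult_right_mono[OF this, of "real q ^ 2"] show ?thesis by (simp add: mult.assoc)
    qed
    then have R1: "(1 - s) * ?R \<ge> 1" using q1 by linarith
    have x: "((1 - s) * ?R - 1) / s \<ge> 0" using R1 s by simp
    have "real ?K0 \<le> ((1 - s) * ?R - 1) / s + 1" using x by linarith
    also have "\<dots> \<le> ?R / s + real q ^ 2"
    proof -
      have "(1 - s) * ?R \<le> 1 * real ?R" using s by (intro mult_right_mono) auto
      then show ?thesis using s q1 by (intro add_mono divide_right_mono) auto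
    qed
    finally show "real (?R + ?K0) \<le> (real N + real N / s + 1) * real q ^ 2"
      by (simp add: distrib_right)
    have t: "t \<ge> 0" using \<tau> by (simp add: t_def)
    have t2: "s ^ 3 * t\<^sup>2 = 3 / 4 * real ?R"
      using s by (simp add: t_def power_mult_distrib \<tau>2)
    have "s * t \<le> real ?R / 4"
    proof (rule power2_le_imp_le)
      have "s * (s * t)\<^sup>2 = 3 / 4 * real ?R" using t2 by (simp add: power2_eq_square power3_eq_cube mult_ac)
      also have "\<dots> \<le> s * (real ?R / 4)\<^sup>2"
      proof -
        have "12 \<le> s * N" using N(1) s by (simp add: field_simps)
        also have "s * N * 1 \<le> s * N * real q ^ 2" using q1 s by (intro mult_left_mono) auto
        finally have "12 \<le> s * real ?R" by simp
        from mult_right_mono[OF this, of "real ?R / 16"] show ?thesis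
          by (simp add: power2_eq_square)
      qed
      finally show "(s * t)\<^sup>2 \<le> (real ?R / 4)\<^sup>2" using s by simp
    qed simp
    moreover have "s * t * (s\<^sup>2 * t + 1) = s ^ 3 * t\<^sup>2 + s * t"
      by (simp add: power2_eq_square power3_eq_cube algebra_simps)
    ultimately have large: "s * t * (s\<^sup>2 * t + 1) \<le> real ?R" using t2 by linarith
    let ?P = "measure_pmf.prob (neg_binomial_pmf ?R s)"
    have "?P {x. \<bar>real x - \<mu>\<bar> \<ge> t} \<le> 2 * exp (- 2 * s ^ 3 * t\<^sup>2 / real ?R)"
      unfolding \<mu>_def using prob_neg_binomial_pmf_abs_ge_bound[of s t ?R] s t large by simp
    also have "- 2 * s ^ 3 * t\<^sup>2 / real ?R = - (3 / 2)"
      unfolding mult.assoc t2 using R_pos by simp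
    also have "2 * exp (- (3 / 2)) \<le> (3 / 5 :: real)"
    proof -
      have "10 / 3 \<le> (29 / 8 :: real)" by simp
      also have "\<dots> \<le> exp (3 / 2)" using exp_lower_Taylor_quadratic[of "3 / 2"] by (simp add: power2_eq_square)
      finally show ?thesis by (simp add: exp_minus field_simps)
    qed
    finally have far: "?P {x. \<bar>real x - \<mu>\<bar> \<ge> t} \<le> 3 / 5" .
    let ?A = "{x::nat. \<bar>real x - \<mu>\<bar> < t}"
    have "?P ?A = 1 - ?P {x. \<bar>real x - \<mu>\<bar> \<ge> t}"
      by (subst measure_pmf.prob_compl[symmetric]) (auto intro!: arg_cong[where f = ?P])
    with far have "2 / 5 \<le> ?P ?A" by linarith
    also have "?P ?A = (\<Sum>x\<in>?A. ?f x)"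
      using card_nat_interval_le(1)[OF t] by (rule measure_measure_pmf_finite)
    also have "\<dots> \<le> (\<Sum>x\<in>?A. ?f ?K0)"
      using neg_binomial_mode[OF s R_pos R1] by (intro sum_mono)
    also have "\<dots> \<le> (2 * t + 1) * ?f ?K0"
      using card_nat_interval_le(2)[OF t] by (simp add: mult_right_mono)
    also have "\<dots> \<le> ((2 * \<tau> + 1) * q) * ?f ?K0"
      using q by (intro mult_right_mono) (auto simp: t_def algebra_simps)
    finally have "2 / 5 \<le> ?f ?K0 * ((2 * \<tau> + 1) * q)" by (simp only: mult.commute)
    then have "(2 / 5) / ((2 * \<tau> + 1) * q) \<le> ?f ?K0"
      using \<tau> q by (subst pos_divide_le_eq) auto
    moreover have "2 * (c / real q) = (2 / 5) / ((2 * \<tau> + 1) * q)"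
      by (simp add: c_def mult.assoc)
    ultimately have mode: "2 * (c / real q) \<le> ?f ?K0" by linarith
    fix j assume j: "j \<le> q"
    have "2 * q\<^sup>2 \<le> ?K0 + 1"
    proof -
      have "2 * real q ^ 2 \<le> (1 - s) * ?R - 1" using R3 q1 by linarith
      also have "\<dots> \<le> ((1 - s) * ?R - 1) / s"
      proof -
        have "x \<le> x / s" if "x \<ge> 0" for x :: real
          using s that by (simp add: le_divide_eq mult_right_le_one_le)
        then show ?thesis using R1 by simp
      qed
      also have "\<dots> \<le> real ?K0" by linarith
      finally have "real (2 * q\<^sup>2) \<le> real ?K0" by simp
      then show ?thesis by linarith
    qed
    from neg_binomial_near_mode[OF s R_pos R1 this j q]
    have "(1 - real j / (2 * real q)) * ?f ?K0 \<le> ?f (?K0 + j)" .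
    moreover have "1 / 2 * ?f ?K0 \<le> (1 - real j / (2 * real q)) * ?f ?K0"
      using j q by (intro mult_right_mono) (auto simp: field_simps)
    ultimately show "c / real q \<le> ?f (?K0 + j)" using mode by linarith
  qed
  show ?thesis
    by (rule exI[of _ "real N + real N / s + 1"], rule exI[of _ c]) (use main c s in auto)
qed

section \<open>Reaching a good phase: an irrational letter phase\<close>

context source
begin

text \<open>The averaging operator for reading one letter different from \<open>i\<close>, as a
  function of the phase. It is not normalised: its total mass is \<open>1 - p i\<close>.\<close>

definition other_letter :: "nat \<Rightarrow> (real \<Rightarrow> real) \<Rightarrow> real \<Rightarrow> real" where
  "other_letter i g y = (\<Sum>j\<in>{1..m} - {i}. p j * g (y + phase n p [j]))"

text \<open>Averages over the number \<open>k\<close> of letters \<open>i\<close> before the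
  \<open>R\<close>-th other letter, cut off at \<open>K\<close>. The factor
  \<open>(1 - p i) ^ R\<close> of the negative binomial weights is left out, since \<open>R\<close>
  applications of \<open>other_letter\<close> supply it. For \<open>R = 0\<close> the truncated
  subtraction leaves only the term \<open>k = 0\<close>, as it should.\<close>

definition neg_binomial_sum :: "nat \<Rightarrow> nat \<Rightarrow> nat \<Rightarrow> (real \<Rightarrow> real) \<Rightarrow> real \<Rightarrow> real" where
  "neg_binomial_sum i R K g y =
    (\<Sum>k\<le>K. real ((k + R - 1) choose k) * p i ^ k * g (y + real k * phase n p [i]))"

lemma neg_binomial_sum_0: "neg_binomial_sum i 0 K g y = g y"
  unfolding neg_binomial_sum_def by (induction K) auto

lemma neg_binomial_sum_cap_0: "neg_binomial_sum i R 0 g y = g y"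
  by (simp add: neg_binomial_sum_def)

text \<open>Pascal's rule. It mirrors the distinction whether the next letter is \<open>i\<close>,
  and is the recursion that the dictionary tree follows.\<close>

lemma neg_binomial_sum_Suc:
  "neg_binomial_sum i (Suc R) (Suc K) g y
    = neg_binomial_sum i R (Suc K) g y + p i * neg_binomial_sum i (Suc R) K g (y + phase n p [i])"
proof -
  let ?g = "\<lambda>k. p i ^ Suc k * g (y + real (Suc k) * phase n p [i])"
  have shift: "y + phase n p [i] + real k * phase n p [i] = y + real (Suc k) * phase n p [i]" for k
    by (simp add: distrib_right)
  have "p i * neg_binomial_sum i (Suc R) K g (y + phase n p [i])
      = (\<Sum>k\<le>K. real ((k + R) choose k) * ?g k)"
    unfolding neg_binomial_sum_def sum_distrib_left shift by (intro sum.cong) (auto simp: mult_ac)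
  moreover have "neg_binomial_sum i R (Suc K) g y = g y + (\<Sum>k\<le>K. real ((k + R) choose Suc k) * ?g k)"
    unfolding neg_binomial_sum_def sum.atMost_Suc_shift by (simp add: mult.assoc)
  moreover have "neg_binomial_sum i (Suc R) (Suc K) g y
      = g y + (\<Sum>k\<le>K. real (Suc (k + R) choose Suc k) * ?g k)"
    unfolding neg_binomial_sum_def sum.atMost_Suc_shift by (simp add: mult.assoc)
  ultimately show ?thesis by (simp add: distrib_right sum.distrib)
qed

lemma neg_binomial_sum_other_letter:
  "neg_binomial_sum i R K (other_letter i g) y
    = (\<Sum>j\<in>{1..m} - {i}. p j * neg_binomial_sum i R K g (y + phase n p [j]))"
  unfolding neg_binomial_sum_def other_letter_def sum_distrib_left
  by (subst sum.swap) (auto intro!: sum.cong simp: mult_ac add_ac)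

lemma neg_binomial_sum_iterate:
  assumes i: "i \<in> {1..m}" and "\<And>z. \<beta> \<le> neg_binomial_sum i R K g z"
  shows "(1 - p i) ^ r * \<beta> \<le> neg_binomial_sum i R K ((other_letter i ^^ r) g) z"
proof (induction r arbitrary: z)
  case 0
  then show ?case using assms(2) by simp
next
  case (Suc r)
  have "(\<Sum>j\<in>{1..m} - {i}. p j) = 1 - p i" using p_sum sum.remove[OF _ i, of p] by simp
  then have "(1 - p i) ^ Suc r * \<beta> = (\<Sum>j\<in>{1..m} - {i}. p j * ((1 - p i) ^ r * \<beta>))"
    by (simp add: sum_distrib_right[symmetric])
  also have "\<dots> \<le> (\<Sum>j\<in>{1..m} - {i}. p j *
      neg_binomial_sum i R K ((other_letter i ^^ r) g) (z + phase n p [j]))"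
    using Suc p_pos by (intro sum_mono mult_left_mono) (auto intro: less_imp_le)
  finally show ?case by (simp add: neg_binomial_sum_other_letter)
qed

text \<open>One branching of the tree: continue with \<open>U\<close> after letter \<open>i\<close>
  and with \<open>B\<close> after any other letter. The lower bounds hold for every starting phase
  because the letter just read shifts it.\<close>

lemma mean_node_lower:
  assumes i: "i \<in> {1..m}" and U: "complete_dict m U" and B: "complete_dict m B"
    and lU: "\<And>v. v \<in> U \<Longrightarrow> length v \<le> L" and lB: "\<And>v. v \<in> B \<Longrightarrow> length v \<le> L"
    and u: "\<And>y. u y \<le> mean U (\<lambda>v. g (y + phase n p v))"
    and b: "\<And>y. b y \<le> mean B (\<lambda>v. g (y + phase n p v))"
  shows "\<exists>D. complete_dict m D \<and> (\<forall>v\<in>D. length v \<le> Suc L) \<and>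
    (\<forall>y. p i * u (y + phase n p [i]) + (\<Sum>j\<in>{1..m} - {i}. p j * b (y + phase n p [j]))
      \<le> mean D (\<lambda>v. g (y + phase n p v)))"
proof -
  define V where "V j = (if j = i then U else B)" for j
  let ?D = "\<Union>j\<in>{1..m}. (#) j ` V j"
  have V: "complete_dict m (V j)" for j using U B by (simp add: V_def)
  have "p i * u (y + phase n p [i]) + (\<Sum>j\<in>{1..m} - {i}. p j * b (y + phase n p [j]))
      \<le> mean ?D (\<lambda>v. g (y + phase n p v))" for y
  proof -
    have letter: "mean (V j) (\<lambda>v. g (y + phase n p (j # v))) = mean (V j) (\<lambda>v. g ((y + phase n p [j]) + phase n p v))"
      if "j \<in> {1..m}" for j
    proof (rule mean_cong)
      fix v assume "v \<in> V j"
      then have "v \<in> lists {1..m}" by (rule subsetD[OF complete_dict_lists[OF V]])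
      then show "g (y + phase n p (j # v)) = g ((y + phase n p [j]) + phase n p v)"
        by (simp only: phase_Cons[OF that] add.assoc)
    qed
    have "mean ?D (\<lambda>v. g (y + phase n p v))
        = (\<Sum>j=1..m. p j * mean (V j) (\<lambda>v. g ((y + phase n p [j]) + phase n p v)))"
      by (subst dict_mean_node) (use complete_dict_finite[OF V] letter in auto)
    also have "\<dots> = p i * mean U (\<lambda>v. g ((y + phase n p [i]) + phase n p v))
        + (\<Sum>j\<in>{1..m} - {i}. p j * mean B (\<lambda>v. g ((y + phase n p [j]) + phase n p v)))"
      using i by (subst sum.remove[of _ i]) (auto simp: V_def intro!: sum.cong)
    also have "\<dots> \<ge> p i * u (y + phase n p [i]) + (\<Sum>j\<in>{1..m} - {i}. p j * b (y + phase n p [j]))"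
      using u b p_pos i by (intro add_mono sum_mono mult_left_mono) (auto intro: less_imp_le)
    finally show ?thesis .
  qed
  moreover have "complete_dict m ?D" using V by (rule complete_dict.node)
  moreover have "\<forall>v\<in>?D. length v \<le> Suc L" using lU lB by (auto simp: V_def split: if_splits)
  ultimately show ?thesis by blast
qed

text \<open>The dictionary reads letters until \<open>R\<close> of them differ from \<open>i\<close>, giving up after more than \<open>K\<close>
  letters \<open>i\<close>. The other letters are independent of the number of letters \<open>i\<close>, which is negative
  binomial.\<close>

lemma neg_binomial_dict:
  assumes i: "i \<in> {1..m}" and g: "\<And>y. 0 \<le> g y"
  shows "\<exists>B. complete_dict m B \<and> (\<forall>v\<in>B. length v \<le> R + K) \<and>
    (\<forall>y. neg_binomial_sum i R K ((other_letter i ^^ R) g) y \<le> mean B (\<lambda>v. g (y + phase n p v)))"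
proof (induction R arbitrary: K)
  case 0
  show ?case
    by (intro exI[of _ "{[]}"]) (auto intro: complete_dict.leaf simp: neg_binomial_sum_0 phase_def)
next
  case (Suc R)
  let ?h = "(other_letter i ^^ R) g"
  show ?case
  proof (induction K)
    case 0
    obtain B where B: "complete_dict m B" "\<forall>v\<in>B. length v \<le> R + 0"
        "\<forall>y. neg_binomial_sum i R 0 ?h y \<le> mean B (\<lambda>v. g (y + phase n p v))"
      using Suc.IH[of 0] by blast
    \<comment> \<open>With no letter \<open>i\<close> left in the budget, the branch after
      \<open>i\<close> only needs some dictionary of admissible length; \<open>B\<close> is reused
      there with the trivial lower bound 0.\<close>
    have "0 \<le> mean B (\<lambda>v. g (y + phase n p v))" for y
      using mean_mono[OF B(1), of "\<lambda>_. 0"] g by (simp add: mean_const[OF B(1)])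
    then obtain D where "complete_dict m D" "\<forall>v\<in>D. length v \<le> Suc (R + 0)"
        "\<forall>y. p i * 0 + (\<Sum>j\<in>{1..m} - {i}. p j * neg_binomial_sum i R 0 ?h (y + phase n p [j]))
          \<le> mean D (\<lambda>v. g (y + phase n p v))"
      using mean_node_lower[OF i B(1) B(1), of "R + 0" "\<lambda>_. 0" g "neg_binomial_sum i R 0 ?h"] B by blast
    then show ?case
      by (intro exI[of _ D]) (simp add: neg_binomial_sum_cap_0 other_letter_def[of i ?h])
  next
    case (Suc K)
    \<comment> \<open>After a letter \<open>i\<close> the budget \<open>K\<close> drops (inner
      induction); after another letter the count \<open>R\<close> drops (outer induction).\<close>
    obtain U where U: "complete_dict m U" "\<forall>v\<in>U. length v \<le> Suc R + K"
        "\<forall>y. neg_binomial_sum i (Suc R) K (other_letter i ?h) y \<le> mean U (\<lambda>v. g (y + phase n p v))"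
      using Suc.IH by auto
    obtain B where B: "complete_dict m B" "\<forall>v\<in>B. length v \<le> R + Suc K"
        "\<forall>y. neg_binomial_sum i R (Suc K) ?h y \<le> mean B (\<lambda>v. g (y + phase n p v))"
      using \<open>\<And>K. \<exists>B. complete_dict m B \<and> (\<forall>v\<in>B. length v \<le> R + K) \<and>
        (\<forall>y. neg_binomial_sum i R K ?h y \<le> mean B (\<lambda>v. g (y + phase n p v)))\<close>[of "Suc K"] by blast
    obtain D where "complete_dict m D" "\<forall>v\<in>D. length v \<le> Suc (R + Suc K)"
        "\<forall>y. p i * neg_binomial_sum i (Suc R) K (other_letter i ?h) (y + phase n p [i])
          + (\<Sum>j\<in>{1..m} - {i}. p j * neg_binomial_sum i R (Suc K) ?h (y + phase n p [j]))
          \<le> mean D (\<lambda>v. g (y + phase n p v))"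
      using mean_node_lower[OF i U(1) B(1), of "R + Suc K"
          "neg_binomial_sum i (Suc R) K (other_letter i ?h)" g "neg_binomial_sum i R (Suc K) ?h"] U B
      by auto
    moreover have "neg_binomial_sum i (Suc R) (Suc K) (other_letter i ?h) y
        = p i * neg_binomial_sum i (Suc R) K (other_letter i ?h) (y + phase n p [i])
          + (\<Sum>j\<in>{1..m} - {i}. p j * neg_binomial_sum i R (Suc K) ?h (y + phase n p [j]))" for y
      by (simp only: neg_binomial_sum_Suc neg_binomial_sum_other_letter[of i R "Suc K"] add.commute)
    ultimately show ?case by (intro exI[of _ D]) simp
  qed
qed

text \<open>Irrationality gives infinitely many reduced fractions \<open>a / q\<close> with error
  below \<open>1 / q ^ 2\<close>, and \<open>T\<close> runs through these \<open>q\<close>. The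
  count of letters \<open>i\<close> has mass at least \<open>c / q\<close> at each of
  \<open>q\<close> consecutive values, one of which brings the phase into the wanted window.\<close>

lemma stages_irrational:
  assumes i: "i \<in> {1..m}" and irr: "phase n p [i] \<notin> \<rat>"
  shows "\<exists>C c. 0 \<le> C \<and> 0 < c \<and> c \<le> 1 \<and> (\<exists>\<T>. infinite \<T> \<and> (\<forall>T\<in>\<T>. T \<ge> 2 \<and> stages C c T))"
proof -
  let ?\<theta> = "phase n p [i]"
  have pi: "0 < 1 - p i" "1 - p i < 1" using p_pos[OF i] p_less_1[OF i] by simp_all
  obtain C c where C: "0 \<le> C" and c: "0 < c" and nb: "\<And>q. q > 0 \<Longrightarrow> \<exists>R K0::nat. real (R + K0) \<le> C * real q ^ 2 \<and>
      (\<forall>j\<le>q. c / real q \<le> pmf (neg_binomial_pmf R (1 - p i)) (K0 + j))"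
    using neg_binomial_local_lower_bound[OF pi] by blast
  define \<T> where "\<T> = {q::nat. q \<ge> 2 \<and> (\<exists>a. (a, int q) \<in> approx_set ?\<theta>)}"
  have "infinite \<T>"
    unfolding infinite_nat_iff_unbounded
  proof
    fix M :: nat
    have "infinite (approx_set ?\<theta>)" using irr rational_iff_finite_approx_set by blast
    from infinite_approx_set[OF this, of "int (M + 2)"]
    obtain a k where k: "(a, k) \<in> approx_set ?\<theta>" "k > int (M + 2)" by blast
    then show "\<exists>q>M. q \<in> \<T>" unfolding \<T>_def by (intro exI[of _ "nat k"]) auto
  qed
  \<comment> \<open>The \<open>+ 1\<close> pays for the \<open>q\<close> extra letters
    \<open>i\<close> beyond \<open>K0\<close>, and the minimum enforces the required bound
    1.\<close>
  moreover have "stages (C + 1) (min c 1) q" if q: "q \<in> \<T>" for q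
    unfolding stages_def
  proof (intro ballI allI)
    fix w :: "nat list" and s :: bool assume w: "w \<in> lists {1..m}"
    from q obtain a where q2: "q \<ge> 2" and a: "coprime a (int q)" "\<bar>?\<theta> - of_int a / of_int (int q)\<bar> < 1 / (of_int (int q))\<^sup>2"
      unfolding \<T>_def approx_set_def by auto
    obtain R K0 where RK: "real (R + K0) \<le> C * real q ^ 2"
      and pmf: "\<And>j. j \<le> q \<Longrightarrow> c / real q \<le> pmf (neg_binomial_pmf R (1 - p i)) (K0 + j)"
      using nb[of q] q2 by auto
    define g :: "real \<Rightarrow> real" where "g y = of_bool (near_integer s (3 / real q) y)" for y
    \<comment> \<open>A single term \<open>k = K0 + j\<close> is enough. The division by
      \<open>(1 - p i) ^ R\<close> compensates for the factor missing from
      \<open>neg_binomial_sum\<close>.\<close>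
    have hit: "c / real q / (1 - p i) ^ R \<le> neg_binomial_sum i R (K0 + q) g z" for z
    proof -
      have "int q > 0" using q2 by simp
      \<comment> \<open>Modulo 1 the phase should fall just below an integer if it is to be rounded
        up, and just above one otherwise.\<close>
      from dense_window[OF this a, of "if s then - (3 / real q) else 0" "z + real K0 * ?\<theta>"]
      obtain j h where j: "j < q" and h:
        "(if s then - (3 / real q) else 0) \<le> z + real K0 * ?\<theta> + real j * ?\<theta> + of_int h"
        "z + real K0 * ?\<theta> + real j * ?\<theta> + of_int h \<le> (if s then - (3 / real q) else 0) + 3 / real q"
        by auto
      let ?y = "z + real (K0 + j) * ?\<theta>"
      have "near_integer s (3 / real q) ?y"
      proof (cases s)
        case True
        then have "?y \<le> of_int (- h)" "of_int (- h) \<le> ?y + 3 / real q"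
          using h by (simp_all add: distrib_right)
        then show ?thesis using True ceiling_le[of ?y "- h"] by (simp add: near_integer_def)
      next
        case False
        then have "of_int (- h) \<le> ?y" "?y - 3 / real q \<le> of_int (- h)"
          using h by (simp_all add: distrib_right)
        then show ?thesis using False le_floor_iff[of "- h" ?y] by (simp add: near_integer_def)
      qed
      then have g1: "g ?y = 1" by (simp add: g_def)
      have "c / real q \<le> real (((K0 + j) + R - 1) choose (K0 + j)) * (1 - p i) ^ R * p i ^ (K0 + j)"
        using pmf[of j] j pi pmf_neg_binomial[of "1 - p i" R "K0 + j"] by simp
      then have "c / real q / (1 - p i) ^ R \<le> real (((K0 + j) + R - 1) choose (K0 + j)) * p i ^ (K0 + j) * g ?y"
        unfolding g1 using pi by (subst pos_divide_le_eq) (simp_all only: mult_ac mult_1_right zero_less_power)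
      also have "\<dots> \<le> neg_binomial_sum i R (K0 + q) g z"
        unfolding neg_binomial_sum_def using j p_pos[OF i]
        by (intro member_le_sum[where f = "\<lambda>k. real ((k + R - 1) choose k) * p i ^ k * g (z + real k * ?\<theta>)"])
           (auto simp: g_def)
      finally show ?thesis .
    qed
    have "\<And>y. 0 \<le> g y" by (simp add: g_def)
    from neg_binomial_dict[of i g R "K0 + q", OF i this] obtain B where B: "complete_dict m B"
        "\<forall>v\<in>B. length v \<le> R + (K0 + q)"
        "\<And>y. neg_binomial_sum i R (K0 + q) ((other_letter i ^^ R) g) y \<le> mean B (\<lambda>v. g (y + phase n p v))"
      by blast
    have "min c 1 / real q \<le> c / real q" by (intro divide_right_mono) auto
    also have "\<dots> = (1 - p i) ^ R * (c / real q / (1 - p i) ^ R)" using pi by simp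
    also have "\<dots> \<le> neg_binomial_sum i R (K0 + q) ((other_letter i ^^ R) g) (phase n p w)"
      using hit by (rule neg_binomial_sum_iterate[OF i])
    also have "\<dots> \<le> mean B (\<lambda>v. g (phase n p w + phase n p v))" by (rule B(3))
    also have "\<dots> = mean B (\<lambda>v. g (phase n p (w @ v)))"
    proof (rule mean_cong)
      fix v assume "v \<in> B"
      then have "v \<in> lists {1..m}" by (rule subsetD[OF complete_dict_lists[OF B(1)]])
      then show "g (phase n p w + phase n p v) = g (phase n p (w @ v))" by (simp only: phase_append[OF w])
    qed
    finally have "min c 1 / real q \<le> mean B (\<lambda>v. of_bool (near_integer s (3 / real q) (phase n p (w @ v))))"
      by (simp add: g_def)
    moreover have "\<forall>v\<in>B. real (length v) \<le> (C + 1) * real q ^ 2"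
    proof
      fix v assume "v \<in> B"
      then have "real (length v) \<le> real (R + K0) + real q" using B(2) by fastforce
      moreover have "real q \<le> real q ^ 2" using q2 by (simp add: power2_eq_square)
      ultimately show "real (length v) \<le> (C + 1) * real q ^ 2" 
        using RK unfolding distrib_right by linarith
    qed
    ultimately show "\<exists>B. complete_dict m B \<and> (\<forall>v\<in>B. real (length v) \<le> (C + 1) * real q ^ 2) \<and>
      min c 1 / real q \<le> mean B (\<lambda>v. of_bool (near_integer s (3 / real q) (phase n p (w @ v))))"
      using B(1) by blast
  qed
  moreover have "q \<ge> 2" if "q \<in> \<T>" for q using that by (simp add: \<T>_def)
  ultimately show ?thesis using C c
    by (intro exI[of _ "C + 1"] exI[of _ "min c 1"] conjI exI[of _ \<T>] ballI) auto
qed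

end

section \<open>Reaching a good phase: rational letter phases\<close>

context source
begin

lemma common_denominator:
  assumes "\<And>i. i \<in> {1..m} \<Longrightarrow> phase n p [i] \<in> \<rat>"
  shows "\<exists>d>0. \<forall>w\<in>lists {1..m}. real d * phase n p w \<in> \<int>"
proof -
  have "\<exists>d>0. \<forall>i\<in>A. real d * phase n p [i] \<in> \<int>" if "finite A" "A \<subseteq> {1..m}" for A
    using that
  proof (induction A rule: finite_induct)
    case empty
    show ?case by (intro exI[of _ 1]) simp
  next
    case (insert i A)
    then obtain d where d: "d > 0" "\<And>j. j \<in> A \<Longrightarrow> real d * phase n p [j] \<in> \<int>" by auto
    obtain a b :: int where b: "b > 0" "phase n p [i] = of_int a / of_int b"
      using assms[of i] insert.prems by (metis Rats_cases' insert_subset)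
    have "real (d * nat b) * phase n p [j] \<in> \<int>" if "j \<in> insert i A" for j
    proof (cases "j = i")
      case True
      have "real (d * nat b) * phase n p [j] = of_int (int d * a)" using b True by simp
      then show ?thesis by (metis Ints_of_int)
    next
      case False
      have "real (d * nat b) * phase n p [j] = of_nat (nat b) * (real d * phase n p [j])" by simp
      then show ?thesis using d(2)[of j] that False by (metis Ints_mult Ints_of_nat insertE)
    qed
    then show ?case using d(1) b(1) by (intro exI[of _ "d * nat b"]) auto
  qed
  from this[of "{1..m}"] obtain d where d: "d > 0" "\<And>i. i \<in> {1..m} \<Longrightarrow> real d * phase n p [i] \<in> \<int>"
    by auto
  have "real d * phase n p w \<in> \<int>" if "w \<in> lists {1..m}" for w
    using that
  proof induction
    case Nil
    then show ?case by (simp add: phase_def)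
  next
    case (Cons i w)
    have "real d * phase n p (i # w) = real d * phase n p [i] + real d * phase n p w"
      by (simp only: phase_Cons[OF Cons.hyps] distrib_left)
    then show ?case using d(2)[OF Cons.hyps(1)] Cons.IH by simp
  qed
  with d(1) show ?thesis by blast
qed

text \<open>Repeating \<open>w\<close> another \<open>d - 1\<close> times returns to phase \<open>0\<close> modulo \<open>1\<close>, and only the residue of
  \<open>d\<close> times the phase of \<open>w\<close> matters.\<close>

lemma bounded_return:
  assumes "\<And>i. i \<in> {1..m} \<Longrightarrow> phase n p [i] \<in> \<rat>"
  shows "\<exists>L. \<forall>w\<in>lists {1..m}. \<exists>v\<in>lists {1..m}. length v \<le> L \<and> phase n p (w @ v) \<in> \<int>"
proof -
  obtain d where d: "d > 0" "\<And>w. w \<in> lists {1..m} \<Longrightarrow> real d * phase n p w \<in> \<int>"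
    using common_denominator[OF assms] by blast
  define ret where "ret r v \<longleftrightarrow> v \<in> lists {1..m} \<and> real r / real d + phase n p v \<in> \<int>" for r v
  \<comment> \<open>One return word is fixed for each residue \<open>r\<close>, and the sum bounds
    all their lengths. For residues without a return word the choice is arbitrary, which only
    enlarges \<open>L\<close>.\<close>
  define L where "L = (\<Sum>r<d. length (SOME v. ret r v))"
  have "\<exists>v\<in>lists {1..m}. length v \<le> L \<and> phase n p (w @ v) \<in> \<int>" if w: "w \<in> lists {1..m}" for w
  proof -
    obtain N where N: "real d * phase n p w = of_int N" using d(2)[OF w] by (auto elim: Ints_cases)
    define r where "r = nat (N mod int d)"
    have r: "r < d" "int r = N mod int d" using d(1) by (simp_all add: r_def nat_less_iff)
    have "phase n p w = of_int N / real d" using N d(1) by (simp add: field_simps)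
    also have "N = (N div int d) * int d + int r" by (simp only: r(2) div_mult_mod_eq)
    also have "real_of_int \<dots> = of_int (N div int d) * real d + real r" by simp
    finally have phase_w: "phase n p w = of_int (N div int d) + real r / real d"
      using d(1) by (simp add: add_divide_distrib)
    have ret_iff: "ret r v \<longleftrightarrow> phase n p (w @ v) \<in> \<int>" if v: "v \<in> lists {1..m}" for v
    proof -
      have "phase n p (w @ v) = of_int (N div int d) + (real r / real d + phase n p v)"
        by (simp only: phase_append[OF w v] phase_w add.assoc)
      moreover have "of_int k + x \<in> \<int> \<longleftrightarrow> x \<in> \<int>" for k and x :: real
        by (metis Ints_add Ints_diff Ints_of_int add_diff_cancel_left')
      ultimately show ?thesis using v by (simp only: ret_def simp_thms)
    qed
    have pow: "concat (replicate k w) \<in> lists {1..m} \<and> phase n p (concat (replicate k w)) = real k * phase n p w"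
      for k
    proof (induction k)
      case 0
      then show ?case by (simp add: phase_def)
    next
      case (Suc k)
      then have "concat (replicate k w) \<in> lists {1..m}" by simp
      moreover from this have "phase n p (w @ concat (replicate k w)) = real (Suc k) * phase n p w"
        using Suc by (simp only: phase_append[OF w]) (simp add: distrib_right)
      ultimately show ?case using w by simp
    qed
    have "phase n p (w @ concat (replicate (d - 1) w)) = real d * phase n p w"
      using pow[of d] d(1) by (cases d) simp_all
    then have "ret r (concat (replicate (d - 1) w))"
      using ret_iff[of "concat (replicate (d - 1) w)"] pow[of "d - 1"] d(2)[OF w] by simp
    then have v: "ret r (SOME v. ret r v)" by (rule someI)
    moreover have "length (SOME v. ret r v) \<le> L"
      unfolding L_def using r(1) by (intro member_le_sum) auto
    ultimately show ?thesis using ret_iff unfolding ret_def by blast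
  qed
  then show ?thesis by blast
qed

lemma word_prob_ge_power:
  assumes "\<And>i. i \<in> {1..m} \<Longrightarrow> a \<le> p i" "0 \<le> a"
  shows "w \<in> lists {1..m} \<Longrightarrow> a ^ length w \<le> word_prob p w"
proof (induction w)
  case (Cons i w)
  from Cons.prems have i: "i \<in> {1..m}" "w \<in> lists {1..m}" by simp_all
  have "a * a ^ length w \<le> p i * word_prob p w"
    using Cons.IH[OF i(2)] assms(1)[OF i(1)] p_pos[OF i(1)] assms(2) by (intro mult_mono) auto
  then show ?case by simp
qed simp

text \<open>From any phase some word of at most \<open>L\<close> letters leads to an integer, which
  is good for both sides. It is read with probability at least \<open>a ^ L\<close>, independent of
  \<open>T\<close>, so every \<open>T \<ge> 2\<close> is admissible.\<close>

lemma stages_rational: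
  assumes "\<And>i. i \<in> {1..m} \<Longrightarrow> phase n p [i] \<in> \<rat>"
  shows "\<exists>C c. 0 \<le> C \<and> 0 < c \<and> c \<le> 1 \<and> (\<exists>\<T>. infinite \<T> \<and> (\<forall>T\<in>\<T>. T \<ge> 2 \<and> stages C c T))"
proof -
  obtain L where L: "\<And>w. w \<in> lists {1..m} \<Longrightarrow> \<exists>v\<in>lists {1..m}. length v \<le> L \<and> phase n p (w @ v) \<in> \<int>"
    using bounded_return[OF assms] by blast
  obtain a where a: "0 < a" "a < 1" "\<And>i. i \<in> {1..m} \<Longrightarrow> a \<le> p i \<and> p i \<le> 1 - a"
    by (rule letter_prob_bounds) blast
  have "stages (real L) (a ^ L) T" if T: "T \<ge> 2" for T
    unfolding stages_def
  proof (intro ballI allI)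
    fix w :: "nat list" and s :: bool assume w: "w \<in> lists {1..m}"
    obtain v where v: "v \<in> lists {1..m}" "length v \<le> L" "phase n p (w @ v) \<in> \<int>" using L[OF w] by blast
    let ?B = "{u \<in> lists {1..m}. length u = length v}"
    let ?g = "\<lambda>u. of_bool (near_integer s (3 / real T) (phase n p (w @ u))) :: real"
    have B: "complete_dict m ?B" by (rule complete_dict_length)
    have gv: "?g v = 1" using v(3) by (auto simp: near_integer_def elim!: Ints_cases)
    have "a ^ L / real T \<le> a ^ L" using a T by (simp add: divide_le_eq mult_left_le)
    also have "\<dots> \<le> a ^ length v" using a v(2) by (intro power_decreasing) auto
    also have "\<dots> \<le> word_prob p v * ?g v"
      unfolding gv using word_prob_ge_power[of a v] a v(1) by simp
    also have "\<dots> \<le> mean ?B ?g"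
      unfolding dict_mean_def
      by (rule member_le_sum[where f = "\<lambda>u. word_prob p u * ?g u"])
         (use v(1) word_prob_pos complete_dict_finite[OF B] in \<open>auto intro!: less_imp_le\<close>)
    finally have "a ^ L / real T \<le> mean ?B ?g" .
    moreover have "\<forall>u\<in>?B. real (length u) \<le> real L * real T ^ 2"
    proof
      fix u assume "u \<in> ?B"
      then have "real (length u) \<le> real L * 1" using v(2) by simp
      also have "\<dots> \<le> real L * real T ^ 2" using T by (intro mult_left_mono one_le_power) auto
      finally show "real (length u) \<le> real L * real T ^ 2" .
    qed
    ultimately show "\<exists>B. complete_dict m B \<and> (\<forall>v\<in>B. real (length v) \<le> real L * real T ^ 2) \<and>
      a ^ L / real T \<le> mean B (\<lambda>v. of_bool (near_integer s (3 / real T) (phase n p (w @ v))))"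
      using B by blast
  qed
  moreover have "infinite {2::nat..}" by (rule infinite_Ici)
  moreover have "0 < a ^ L" "a ^ L \<le> 1" using a by (simp_all add: power_le_one)
  ultimately show ?thesis
    by (intro exI[of _ "real L"] exI[of _ "a ^ L"] conjI exI[of _ "{2..}"]) auto
qed

end

theorem theorem2:
  fixes m n :: nat and p :: "nat \<Rightarrow> real"
  assumes "m \<ge> 2" and "n \<ge> 2" and "bernoulli_source m p"
  shows "\<exists>c>0. \<exists>\<T> :: nat set. infinite \<T> \<and>
    (\<forall>T\<in>\<T>. T \<ge> 2 \<and>
      (\<exists>W \<phi>. word_code m n W \<phi> \<and> decipherable W \<phi> \<and>
         redundancy m n p W \<phi> \<le> c * inverse (average_delay p W) * inverse (real T ^ 2) \<and>
         average_delay p W \<le> c * real T ^ 3 \<and>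
         real (max_delay W) \<le> c * real T ^ 3 * ln (real T)))"
proof -
  interpret source m n p using assms by unfold_locales
  \<comment> \<open>Either all letter phases are rational or some letter has an irrational
    one.\<close>
  obtain C c \<T> where C: "0 \<le> C" "0 < c" "c \<le> 1" and \<T>: "infinite \<T>"
    and st: "\<And>T. T \<in> \<T> \<Longrightarrow> T \<ge> 2 \<and> stages C c T"
    using stages_rational stages_irrational by blast
  obtain K where K: "K > 0" "\<And>T. T \<ge> 2 \<Longrightarrow> stages C c T \<Longrightarrow>
      \<exists>W \<phi>. word_code m n W \<phi> \<and> decipherable W \<phi> \<and>
        redundancy m n p W \<phi> \<le> K * inverse (average_delay p W) * inverse (real T ^ 2) \<and>
        average_delay p W \<le> K * real T ^ 3 \<and>
        real (max_delay W) \<le> K * real T ^ 3 * ln (real T)"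
    using code_from_stages[OF C] by blast
  show ?thesis
    by (intro exI[of _ K] exI[of _ \<T>] conjI ballI) (use K \<T> st in blast)+
qed

end
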